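(* Let $\alpha,\beta,k>0$, $T_{\mathrm m}\in\mathbb R$, let $c>0$ be an arbitrary controller gain, and consider the closed-loop system consisting of the one-phase Stefan problem $$T_t(x,t)=\alpha T_{xx}(x,t)\ (0\le x\le s(t)),\quad -kT_x(0,t)=q_{\mathrm c}(t),\quad T(s(t),t)=T_{\mathrm m},\quad \dot s(t)=-\beta T_x(s(t),t),$$ with $T(x,0)=T_0(x)$, $s(0)=s_0>0$, and the control law $$q_{\mathrm c}(t)=-ck\left(\frac1\alpha\int_0^{s(t)}(T(x,t)-T_{\mathrm m})\,dx+\frac1\beta(s(t)-s_{\mathrm r})\right).$$ Assume that the initial conditions $(T_0,s_0)$ are compatible with the control law and that, for some constant $H$, $0\le T_0(x)-T_{\mathrm m}\le H(s_0-x)$ for all $x\in[0,s_0]$. Then, for any reference setpoint $s_{\mathrm r}$ satisfying $$s_{\mathrm r}>s_0+\frac{\beta}{\alpha}\int_0^{s_0}(T_0(x)-T_{\mathrm m})\,dx,$$ the closed-loop system maintains $T(x,t)\ge T_{\mathrm m}$ for all $x\in[0,s(t)]$ and $t\ge 0$, and it is exponentially stable in the sense of the norm $$\|T-T_{\mathrm m}\|_{\mathcal H_1}^2+(s(t)-s_{\mathrm r})^2 .$$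
   Context: The unknowns are the liquid temperature $T(x,t)$, $0\le x\le s(t)$, and the moving interface $s(t)>0$; $(T,s)$ denotes the (classical) solution of the closed-loop system for $t\ge0$. Norms at time $t$: $\|u\|_{\mathcal L_2}^2=\int_0^{s(t)}u(x,t)^2dx$ and $\|u\|_{\mathcal H_1}^2=\|u\|_{\mathcal L_2}^2+\|u_x\|_{\mathcal L_2}^2$. "Exponentially stable in the sense of the norm $\Phi(t)$" means: there exist constants $D,b>0$, depending only on the system parameters, the gain and the setpoint (not on the particular solution), such that $\Phi(t)\le D\,\Phi(0)e^{-bt}$ for all $t\ge0$. "Compatible with the control law" means that the initial data satisfy the boundary conditions at $t=0$: $T_0(s_0)=T_{\mathrm m}$ and $-kT_0'(0)=q_{\mathrm c}(0)$. *)

theory Defs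
  imports "HOL-Analysis.Analysis"
begin

text \<open>A temperature field is written \<open>T x t\<close> and the interface position \<open>s t\<close>. All conditions
  on \<open>T\<close> only concern the moving domain \<open>0 \<le> x \<le> s t\<close>, \<open>t \<ge> 0\<close>.\<close>

definition stefan_domain :: "(real \<Rightarrow> real) \<Rightarrow> (real \<times> real) set" where
  "stefan_domain s = {(x, t). 0 \<le> t \<and> 0 \<le> x \<and> x \<le> s t}"

definition stefan_domain_pos :: "(real \<Rightarrow> real) \<Rightarrow> (real \<times> real) set" where
  "stefan_domain_pos s = {(x, t). 0 < t \<and> 0 \<le> x \<and> x \<le> s t}"

text \<open>Classical solution for all \<open>t \<ge> 0\<close> of the one-phase Stefan problem with boundary heat flux \<open>q\<close>:
  \<open>T\<close> and \<open>T\<^sub>x\<close> are continuous on the domain including \<open>t = 0\<close>; \<open>T\<^sub>t\<close> and \<open>T\<^sub>x\<^sub>x\<close> are continuous up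
  to the lateral boundary for \<open>t > 0\<close>, and the heat equation is only required there, so that the
  initial profile need not be twice differentiable. Derivatives are taken within the domain,
  that is, one-sided where a slice of the domain ends. A boundary point \<open>(s t, t)\<close> may be isolated in
  its time slice; there \<open>T\<^sub>t\<close> is determined by continuity. Continuity of \<open>T\<^sub>x\<close> and the last conjunct
  make \<open>s\<close> continuously differentiable.\<close>

definition stefan_solution ::
  "real \<Rightarrow> real \<Rightarrow> real \<Rightarrow> real \<Rightarrow> (real \<Rightarrow> real) \<Rightarrow> (real \<Rightarrow> real) \<Rightarrow> real \<Rightarrow>
    (real \<Rightarrow> real \<Rightarrow> real) \<Rightarrow> (real \<Rightarrow> real) \<Rightarrow> bool" where
  "stefan_solution \<alpha> \<beta> k Tm q T0 s0 T s \<longleftrightarrow>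
     (\<forall>t\<ge>0. s t > 0) \<and>
     s 0 = s0 \<and>
     (\<forall>x\<in>{0..s0}. T x 0 = T0 x) \<and>
     (\<exists>Tx Txx Tt.
        continuous_on (stefan_domain s) (\<lambda>(x, t). T x t) \<and>
        continuous_on (stefan_domain s) (\<lambda>(x, t). Tx x t) \<and>
        continuous_on (stefan_domain_pos s) (\<lambda>(x, t). Txx x t) \<and>
        continuous_on (stefan_domain_pos s) (\<lambda>(x, t). Tt x t) \<and>
        (\<forall>(x, t)\<in>stefan_domain s.
           ((\<lambda>y. T y t) has_real_derivative Tx x t) (at x within {0..s t})) \<and>
        (\<forall>(x, t)\<in>stefan_domain_pos s.
           ((\<lambda>y. Tx y t) has_real_derivative Txx x t) (at x within {0..s t}) \<and>
           ((\<lambda>\<tau>. T x \<tau>) has_real_derivative Tt x t) (at t within {\<tau>. 0 \<le> \<tau> \<and> x \<le> s \<tau>}) \<and>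
           Tt x t = \<alpha> * Txx x t) \<and>
        (\<forall>t\<ge>0. - k * Tx 0 t = q t \<and>
               T (s t) t = Tm \<and>
               (s has_real_derivative - \<beta> * Tx (s t) t) (at t within {0..})))"

text \<open>Feedback value for the temperature profile \<open>v\<close> on \<open>[0, L]\<close> and interface position \<open>L\<close>.\<close>

definition heat_control ::
  "real \<Rightarrow> real \<Rightarrow> real \<Rightarrow> real \<Rightarrow> real \<Rightarrow> real \<Rightarrow> (real \<Rightarrow> real) \<Rightarrow> real \<Rightarrow> real" where
  "heat_control \<alpha> \<beta> k Tm c sr v L =
     - c * k * (1 / \<alpha> * integral {0..L} (\<lambda>x. v x - Tm) + 1 / \<beta> * (L - sr))"

definition closed_loop_solution ::
  "real \<Rightarrow> real \<Rightarrow> real \<Rightarrow> real \<Rightarrow> real \<Rightarrow> real \<Rightarrow> (real \<Rightarrow> real) \<Rightarrow> real \<Rightarrow>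
    (real \<Rightarrow> real \<Rightarrow> real) \<Rightarrow> (real \<Rightarrow> real) \<Rightarrow> bool" where
  "closed_loop_solution \<alpha> \<beta> k Tm c sr T0 s0 T s \<longleftrightarrow>
     stefan_solution \<alpha> \<beta> k Tm (\<lambda>t. heat_control \<alpha> \<beta> k Tm c sr (\<lambda>x. T x t) (s t)) T0 s0 T s"

definition compatible_initial_data ::
  "real \<Rightarrow> real \<Rightarrow> real \<Rightarrow> real \<Rightarrow> real \<Rightarrow> real \<Rightarrow> (real \<Rightarrow> real) \<Rightarrow> real \<Rightarrow> bool" where
  "compatible_initial_data \<alpha> \<beta> k Tm c sr T0 s0 \<longleftrightarrow>
     T0 s0 = Tm \<and>
     (\<exists>d. (T0 has_real_derivative d) (at 0 within {0..s0}) \<and>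
          - k * d = heat_control \<alpha> \<beta> k Tm c sr T0 s0)"

text \<open>Squared norms on \<open>[0, L]\<close>. The two-sided derivative \<open>deriv u\<close> is meaningful on the open
  interval, which suffices for the integral.\<close>

definition l2_norm_sq :: "real \<Rightarrow> (real \<Rightarrow> real) \<Rightarrow> real" where
  "l2_norm_sq L u = integral {0..L} (\<lambda>x. (u x)\<^sup>2)"

definition h1_norm_sq :: "real \<Rightarrow> (real \<Rightarrow> real) \<Rightarrow> real" where
  "h1_norm_sq L u = l2_norm_sq L u + l2_norm_sq L (deriv u)"

definition stefan_error ::
  "real \<Rightarrow> real \<Rightarrow> (real \<Rightarrow> real \<Rightarrow> real) \<Rightarrow> (real \<Rightarrow> real) \<Rightarrow> real \<Rightarrow> real" where
  "stefan_error Tm sr T s t = h1_norm_sq (s t) (\<lambda>x. T x t - Tm) + (s t - sr)\<^sup>2"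

end

theory Submission
  imports Defs
begin

text \<open>Write \<open>u = T - Tm\<close>. The control law makes \<open>p = - u\<^sub>x(0, t)\<close>, a multiple of the heat flux, satisfy
  \<open>p' = - c p\<close>; the setpoint condition says \<open>p(0) > 0\<close>, so \<open>p\<close> stays positive and decays exponentially.
  By the maximum principle \<open>u \<ge> 0\<close>, hence \<open>s' \<ge> 0\<close> and \<open>s < s\<^sub>r\<close>. Instead of a backstepping transformation,
  stability uses the functional \<open>\<integral> u\<^sub>x\<^sup>2 - 2 p u(0, t)\<close>: its derivative is
  \<open>- 2 \<alpha> \<integral> u\<^sub>x\<^sub>x\<^sup>2 + \<beta> u\<^sub>x(s, t)\<^sup>3 + 2 c p u(0, t)\<close>, where the boundary term is nonpositive, the first
  term dominates \<open>\<integral> u\<^sub>x\<^sup>2\<close> up to \<open>p\<^sup>2\<close> by a Poincare inequality, and \<open>p\<close> is an exponentially small source.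
  The difference \<open>s - s\<^sub>r\<close> is recovered from \<open>p\<close> and \<open>\<integral> u\<close> through the control law.

  No mixed derivative \<open>u\<^sub>x\<^sub>t\<close> is available, so \<open>\<integral> u\<^sub>x\<^sup>2\<close> is differentiated through difference quotients and
  integration by parts. As \<open>s\<close> increases, \<open>[0, s t]\<close> stays inside the domain after time \<open>t\<close> but not before, so
  these derivatives are taken from the right.\<close>

subsection \<open>Real functions\<close>

lemma integral_scale_unit:
  fixes f :: "real \<Rightarrow> real"
  assumes "a \<le> b" and "continuous_on {a..b} f"
  shows "integral {a..b} f = (b - a) * integral {0..1} (\<lambda>y. f (a + y * (b - a)))"
proof (cases "a = b")
  case False
  then have ab: "a < b" using assms by simp
  have "(f has_integral integral {a..b} f) (cbox a b)"
    using assms by (simp add: integrable_continuous_real integrable_integral)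
  from has_integral_affinity'[OF this, of "b - a" a] ab
  have "((\<lambda>y. f ((b - a) * y + a)) has_integral integral {a..b} f / (b - a)) {0..1}"
    by (simp add: field_simps)
  then have "integral {0..1} (\<lambda>y. f (a + y * (b - a))) = integral {a..b} f / (b - a)"
    by (simp add: integral_unique algebra_simps)
  then show ?thesis using ab by simp
qed simp

text \<open>Because \<open>g\<close> vanishes at \<open>t\<close>, the difference quotient of the
  product is that of \<open>g\<close> times \<open>G\<close>, so continuity of \<open>G\<close> at
  \<open>t\<close> suffices. Below, \<open>G\<close> is a mean value or a spatial derivative for
  which no time derivative is at hand.\<close>

lemma has_real_derivative_mult_zero:
  fixes g G :: "real \<Rightarrow> real"
  assumes "(g has_real_derivative d) (at t within S)" and "g t = 0"
    and "(G \<longlongrightarrow> G t) (at t within S)"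
  shows "((\<lambda>\<tau>. g \<tau> * G \<tau>) has_real_derivative d * G t) (at t within S)"
proof -
  have "((\<lambda>y. (g y - g t) / (y - t) * G y) \<longlongrightarrow> d * G t) (at t within S)"
    using assms by (intro tendsto_mult) (auto simp: has_field_derivative_iff)
  then show ?thesis using assms(2) by (simp add: has_field_derivative_iff)
qed

text \<open>At the infimum \<open>z\<close> of the times with \<open>f > 0\<close>, continuity gives
  \<open>f z = 0\<close>, and \<open>f \<le> 0\<close> holds before. A negative right derivative
  keeps \<open>f\<close> negative just after \<open>z\<close>, against the infimum.
  \<open>step\<close> may assume \<open>f \<le> 0\<close> on the whole past, which permits
  bootstrapping.\<close>

lemma right_derivative_barrier:
  fixes f :: "real \<Rightarrow> real"
  assumes cont: "continuous_on {0..} f" and "f 0 < 0"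
    and step: "\<And>t. 0 < t \<Longrightarrow> (\<And>\<tau>. 0 \<le> \<tau> \<Longrightarrow> \<tau> \<le> t \<Longrightarrow> f \<tau> \<le> 0) \<Longrightarrow> f t = 0 \<Longrightarrow>
      \<exists>d<0. (f has_real_derivative d) (at_right t)"
    and "0 \<le> t"
  shows "f t \<le> 0"
proof (rule ccontr)
  assume "\<not> f t \<le> 0"
  define S where "S = {\<tau>. 0 \<le> \<tau> \<and> \<tau> \<le> t \<and> f \<tau> > 0}"
  have S: "t \<in> S" "bdd_below S" using \<open>\<not> f t \<le> 0\<close> \<open>0 \<le> t\<close> by (auto simp: S_def intro: bdd_belowI[of _ 0])
  define z where "z = Inf S"
  have z0: "0 \<le> z" unfolding z_def using S by (intro cInf_greatest) (auto simp: S_def)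
  have zt: "z \<le> t" unfolding z_def using S by (intro cInf_lower) auto
  have below: "f \<tau> \<le> 0" if "0 \<le> \<tau>" "\<tau> < z" for \<tau>
  proof (rule ccontr)
    assume "\<not> f \<tau> \<le> 0"
    then have "\<tau> \<in> S" using that zt by (auto simp: S_def)
    then show False using cInf_lower[OF _ S(2)] that z_def by force
  qed
  have above: "\<exists>\<tau>\<in>S. z \<le> \<tau> \<and> \<tau> < z + d" if "d > 0" for d
  proof -
    have "\<exists>\<tau>\<in>S. \<tau> < z + d" using S that unfolding z_def by (intro cInf_lessD) auto
    then show ?thesis using cInf_lower[OF _ S(2)] z_def by auto
  qed
  have cz: "\<exists>d>0. \<forall>y\<ge>0. \<bar>y - z\<bar> < d \<longrightarrow> \<bar>f y - f z\<bar> < e" if "e > 0" for e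
    using cont that z0 unfolding continuous_on_iff dist_real_def by (metis atLeast_iff)
  have fz: "f z \<le> 0"
  proof (rule ccontr)
    assume fz: "\<not> f z \<le> 0"
    then obtain d where d: "d > 0" "\<And>y. y \<ge> 0 \<Longrightarrow> \<bar>y - z\<bar> < d \<Longrightarrow> \<bar>f y - f z\<bar> < f z"
      using cz[of "f z"] by auto
    have "z > 0" using fz z0 \<open>f 0 < 0\<close> by (cases "z = 0") auto
    define y where "y = max 0 (z - d/2)"
    have "f y \<le> 0" using below \<open>z > 0\<close> d(1) by (auto simp: y_def)
    moreover have "\<bar>f y - f z\<bar> < f z" using d \<open>z > 0\<close> by (intro d(2)) (auto simp: y_def)
    ultimately show False by linarith
  qed
  have "f z = 0"
  proof (rule ccontr)
    assume "f z \<noteq> 0"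
    then obtain d where d: "d > 0" "\<And>y. y \<ge> 0 \<Longrightarrow> \<bar>y - z\<bar> < d \<Longrightarrow> \<bar>f y - f z\<bar> < - f z"
      using cz[of "- f z"] fz by auto
    then obtain \<tau> where "\<tau> \<in> S" "z \<le> \<tau>" "\<tau> < z + d" using above by blast
    then show False using d(2)[of \<tau>] z0 by (auto simp: S_def)
  qed
  moreover have "z > 0" using z0 \<open>f z = 0\<close> \<open>f 0 < 0\<close> by (cases "z = 0") auto
  moreover have "f \<tau> \<le> 0" if "0 \<le> \<tau>" "\<tau> \<le> z" for \<tau>
    using below[of \<tau>] fz that by (cases "\<tau> = z") auto
  ultimately obtain l where l: "l < 0" "(f has_real_derivative l) (at_right z)" using step by blast
  obtain d where d: "d > 0" "\<And>h. h > 0 \<Longrightarrow> h < d \<Longrightarrow> f (z + h) < f z"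
    using has_real_derivative_neg_dec_right[OF l(2,1)] by auto
  obtain \<tau> where \<tau>: "\<tau> \<in> S" "z \<le> \<tau>" "\<tau> < z + d" using above[OF d(1)] by blast
  then show False using d(2)[of "\<tau> - z"] fz \<open>f z = 0\<close> by (cases "\<tau> = z") (auto simp: S_def)
qed

text \<open>Cauchy-Schwarz against the constant 1, read off from the nonnegative integral of
  \<open>(f x - m)\<^sup>2\<close> with the mean value \<open>m\<close>.\<close>

lemma integral_square_le:
  fixes f :: "real \<Rightarrow> real"
  assumes "a \<le> b" and "continuous_on {a..b} f"
  shows "(integral {a..b} f)\<^sup>2 \<le> (b - a) * integral {a..b} (\<lambda>x. (f x)\<^sup>2)"
proof (cases "a = b")
  case False
  then have ab: "b - a > 0" using assms by simp
  define m where "m = integral {a..b} f / (b - a)"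
  have I: "integral {a..b} f = m * (b - a)" using ab by (simp add: m_def)
  have i: "f integrable_on {a..b}" "(\<lambda>x. (f x)\<^sup>2) integrable_on {a..b}"
    using assms(2) by (auto intro!: integrable_continuous_real continuous_intros)
  have "0 \<le> integral {a..b} (\<lambda>x. (f x - m)\<^sup>2)"
    using assms(2) by (intro integral_nonneg integrable_continuous_real continuous_intros) auto
  also have "(\<lambda>x. (f x - m)\<^sup>2) = (\<lambda>x. (f x)\<^sup>2 - 2 * m * f x + m\<^sup>2)"
    by (auto simp: power2_eq_square algebra_simps)
  also have "integral {a..b} \<dots> = integral {a..b} (\<lambda>x. (f x)\<^sup>2) - 2 * m * integral {a..b} f + m\<^sup>2 * (b - a)"
  proof (rule integral_unique)
    show "((\<lambda>x. (f x)\<^sup>2 - 2 * m * f x + m\<^sup>2) has_integral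
        integral {a..b} (\<lambda>x. (f x)\<^sup>2) - 2 * m * integral {a..b} f + m\<^sup>2 * (b - a)) {a..b}"
      using i assms(1) has_integral_const_real[of "m\<^sup>2" a b]
      by (intro has_integral_add has_integral_diff has_integral_mult_right integrable_integral)
        (auto simp: mult.commute)
  qed
  finally have "m\<^sup>2 * (b - a) \<le> integral {a..b} (\<lambda>x. (f x)\<^sup>2)"
    using I by (simp add: power2_eq_square algebra_simps)
  then have "(b - a) * (m\<^sup>2 * (b - a)) \<le> (b - a) * integral {a..b} (\<lambda>x. (f x)\<^sup>2)"
    using ab by (intro mult_left_mono) auto
  then show ?thesis unfolding I by (simp add: power2_eq_square algebra_simps)
qed simp

lemma has_real_derivative_at_left_nonpos_at_min:
  fixes f :: "real \<Rightarrow> real"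
  assumes "(f has_real_derivative d) (at x within S)" and "{x - e..x} \<subseteq> S" and "e > 0"
    and "\<And>y. x - e \<le> y \<Longrightarrow> y \<le> x \<Longrightarrow> f x \<le> f y"
  shows "d \<le> 0"
proof (rule ccontr)
  assume "\<not> d \<le> 0"
  then obtain h where h: "h > 0" "\<And>y. y > 0 \<Longrightarrow> x - y \<in> S \<Longrightarrow> y < h \<Longrightarrow> f (x - y) < f x"
    using has_real_derivative_pos_inc_left[OF assms(1)] by force
  define y where "y = min (h/2) e"
  have "f (x - y) < f x" using h(1) assms(2,3) by (intro h(2)) (auto simp: y_def)
  then show False using assms(3) assms(4)[of "x - y"] h(1) by (auto simp: y_def)
qed

lemma has_real_derivative_at_right_nonneg_at_min:
  fixes f :: "real \<Rightarrow> real"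
  assumes "(f has_real_derivative d) (at x within S)" and "{x..x + e} \<subseteq> S" and "e > 0"
    and "\<And>y. x \<le> y \<Longrightarrow> y \<le> x + e \<Longrightarrow> f x \<le> f y"
  shows "0 \<le> d"
proof (rule ccontr)
  assume "\<not> 0 \<le> d"
  then obtain h where h: "h > 0" "\<And>y. y > 0 \<Longrightarrow> x + y \<in> S \<Longrightarrow> y < h \<Longrightarrow> f (x + y) < f x"
    using has_real_derivative_neg_dec_right[OF assms(1)] by force
  define y where "y = min (h/2) e"
  have "f (x + y) < f x" using h(1) assms(2,3) by (intro h(2)) (auto simp: y_def)
  then show False using assms(3) assms(4)[of "x + y"] h(1) by (auto simp: y_def)
qed

text \<open>If \<open>d\<close> were negative, \<open>g x = 0\<close> would make \<open>g\<close>
  negative just to the right of \<open>x\<close>, and the mean value theorem would push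
  \<open>f\<close> below \<open>f x\<close>.\<close>

lemma second_derivative_nonneg_at_min:
  fixes f g :: "real \<Rightarrow> real"
  assumes f: "\<And>y. a < y \<Longrightarrow> y < b \<Longrightarrow> (f has_real_derivative g y) (at y)"
    and g: "(g has_real_derivative d) (at x)" and x: "a < x" "x < b"
    and min: "\<And>y. a < y \<Longrightarrow> y < b \<Longrightarrow> f x \<le> f y"
  shows "0 \<le> d"
proof (rule ccontr)
  assume "\<not> 0 \<le> d"
  define e where "e = min (x - a) (b - x) / 2"
  have e: "e > 0" "a < x - e" "x + e < b"
    using x by (auto simp: e_def min_def field_simps)
  have "g x = 0"
    using DERIV_local_min[OF f[OF x] e(1)] min e by fastforce
  obtain h where h: "h > 0" "\<And>y. y > 0 \<Longrightarrow> y < h \<Longrightarrow> g (x + y) < 0"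
    using has_real_derivative_neg_dec_right[OF g] \<open>\<not> 0 \<le> d\<close> \<open>g x = 0\<close> by auto
  define y where "y = min (h/2) e"
  have y: "y > 0" "y < h" "x + y < b" using h(1) e by (auto simp: y_def)
  have "\<exists>z. x < z \<and> z < x + y \<and> f (x + y) - f x = (x + y - x) * g z"
    using y x by (intro MVT2 f) auto
  then obtain z where z: "x < z" "z < x + y" "f (x + y) - f x = y * g z" by auto
  then have "g z < 0" using h(2)[of "z - x"] y by auto
  then have "y * g z < 0" using y(1) by (simp add: mult_pos_neg)
  then have "f (x + y) < f x" using z(3) by linarith
  then show False using min[of "x + y"] x y by auto
qed

text \<open>Half of the dissipation rate \<open>\<alpha> / sr\<^sup>2\<close> is spent on Young's
  inequality; the other half is at least twice this rate, and the spare copy absorbs the source in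
  \<open>lyap_decay\<close>. The bound \<open>c / 2\<close> keeps it below the rate \<open>c\<close>
  of the squared flux.\<close>

definition decay_rate :: "real \<Rightarrow> real \<Rightarrow> real \<Rightarrow> real" where
  "decay_rate \<alpha> c sr = min (\<alpha> / (4 * sr\<^sup>2)) (c / 2)"

text \<open>Coefficient of the squared flux in \<open>deriv_lyap\<close>: the first summand is the
  boundary term of \<open>energy_le\<close>, the second comes from Young's inequality.\<close>

definition source_const :: "real \<Rightarrow> real \<Rightarrow> real \<Rightarrow> real" where
  "source_const \<alpha> c sr = 2 * \<alpha> / sr + 2 * sr ^ 3 * c\<^sup>2 / \<alpha>"

text \<open>Converts the initial error into a bound on the squared initial flux, which keeps the
  final constants independent of the solution.\<close>

definition flux_const :: "real \<Rightarrow> real \<Rightarrow> real \<Rightarrow> real \<Rightarrow> real" where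
  "flux_const \<alpha> \<beta> c sr = 2 * c\<^sup>2 * (sr / \<alpha>\<^sup>2 + 1 / \<beta>\<^sup>2)"

text \<open>The first two summands are twice the factor in the barrier height \<open>A\<close> of
  \<open>energy_decay\<close>; the last one is the flux term met when returning from
  \<open>lyap\<close> to \<open>energy\<close>.\<close>

definition energy_const :: "real \<Rightarrow> real \<Rightarrow> real \<Rightarrow> real \<Rightarrow> real" where
  "energy_const \<alpha> \<beta> c sr =
    4 + 8 * source_const \<alpha> c sr * flux_const \<alpha> \<beta> c sr / decay_rate \<alpha> c sr + 16 * sr * flux_const \<alpha> \<beta> c sr"

text \<open>The bracket collects the L2 norm, the energy itself and the mass part of
  \<open>(s t - sr)\<^sup>2\<close>; the last summand is the flux part of that square.\<close>

definition error_const :: "real \<Rightarrow> real \<Rightarrow> real \<Rightarrow> real \<Rightarrow> real" where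
  "error_const \<alpha> \<beta> c sr =
    (sr\<^sup>2 + 1 + 2 * \<beta>\<^sup>2 * sr ^ 3 / \<alpha>\<^sup>2) * energy_const \<alpha> \<beta> c sr + 8 * \<beta>\<^sup>2 * flux_const \<alpha> \<beta> c sr / c\<^sup>2"

lemma consts_pos:
  assumes "\<alpha> > 0" "\<beta> > 0" "c > 0" "sr > 0"
  shows "decay_rate \<alpha> c sr > 0" "source_const \<alpha> c sr > 0" "flux_const \<alpha> \<beta> c sr > 0"
    "energy_const \<alpha> \<beta> c sr > 0" "error_const \<alpha> \<beta> c sr > 0"
proof -
  show 1: "decay_rate \<alpha> c sr > 0" "source_const \<alpha> c sr > 0" "flux_const \<alpha> \<beta> c sr > 0"
    using assms by (auto simp: decay_rate_def source_const_def flux_const_def intro!: add_pos_pos mult_pos_pos divide_pos_pos)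
  show 2: "energy_const \<alpha> \<beta> c sr > 0"
    unfolding energy_const_def using assms 1 by (intro add_pos_pos mult_pos_pos divide_pos_pos) auto
  show "error_const \<alpha> \<beta> c sr > 0"
    unfolding error_const_def using assms 1 2 by (intro add_pos_pos mult_pos_pos divide_pos_pos) auto
qed

lemma sum_square_le: "(a + b)\<^sup>2 \<le> 2 * a\<^sup>2 + 2 * (b::real)\<^sup>2"
  using zero_le_power2[of "a - b"] by (simp add: power2_eq_square algebra_simps)

lemma young_weighted: "2 * a * b \<le> k * a\<^sup>2 + b\<^sup>2 / (k::real)" if "k > 0"
proof -
  have "0 \<le> (k * a - b)\<^sup>2 / k" using that by simp
  also have "\<dots> = k * a\<^sup>2 + b\<^sup>2 / k - 2 * a * b"
    using that by (simp add: power2_eq_square field_simps)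
  finally show ?thesis by simp
qed

subsection \<open>Heat equation on the moving domain\<close>

text \<open>Here \<open>u\<close> stands for \<open>T - Tm\<close>, and \<open>w\<close>,
  \<open>r\<close>, \<open>\<theta>\<close> for its first and second derivative in space and its
  derivative in time. \<open>flux\<close> is the control law divided by \<open>- k\<close>, and
  \<open>init_flux\<close> is the setpoint condition.\<close>

locale stefan_flow =
  fixes \<alpha> \<beta> c sr :: real and u w r \<theta> :: "real \<Rightarrow> real \<Rightarrow> real" and s :: "real \<Rightarrow> real"
  assumes \<alpha>: "\<alpha> > 0" and \<beta>: "\<beta> > 0" and c: "c > 0"
    and s_pos: "\<And>t. 0 \<le> t \<Longrightarrow> 0 < s t"
    and cont_u: "continuous_on (stefan_domain s) (\<lambda>(x, t). u x t)"
    and cont_w: "continuous_on (stefan_domain s) (\<lambda>(x, t). w x t)"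
    and cont_r: "continuous_on (stefan_domain_pos s) (\<lambda>(x, t). r x t)"
    and cont_\<theta>: "continuous_on (stefan_domain_pos s) (\<lambda>(x, t). \<theta> x t)"
    and deriv_u: "\<And>x t. 0 \<le> t \<Longrightarrow> 0 \<le> x \<Longrightarrow> x \<le> s t \<Longrightarrow>
      ((\<lambda>y. u y t) has_real_derivative w x t) (at x within {0..s t})"
    and deriv_w: "\<And>x t. 0 < t \<Longrightarrow> 0 \<le> x \<Longrightarrow> x \<le> s t \<Longrightarrow>
      ((\<lambda>y. w y t) has_real_derivative r x t) (at x within {0..s t})"
    and deriv_t: "\<And>x t. 0 < t \<Longrightarrow> 0 \<le> x \<Longrightarrow> x \<le> s t \<Longrightarrow>
      ((\<lambda>\<tau>. u x \<tau>) has_real_derivative \<theta> x t) (at t within {\<tau>. 0 \<le> \<tau> \<and> x \<le> s \<tau>})"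
    and heat: "\<And>x t. 0 < t \<Longrightarrow> 0 \<le> x \<Longrightarrow> x \<le> s t \<Longrightarrow> \<theta> x t = \<alpha> * r x t"
    and u_s: "\<And>t. 0 \<le> t \<Longrightarrow> u (s t) t = 0"
    and deriv_s: "\<And>t. 0 \<le> t \<Longrightarrow> (s has_real_derivative - \<beta> * w (s t) t) (at t within {0..})"
    and flux: "\<And>t. 0 \<le> t \<Longrightarrow> w 0 t = c * (integral {0..s t} (\<lambda>x. u x t) / \<alpha> + (s t - sr) / \<beta>)"
    and init_nonneg: "\<And>x. 0 \<le> x \<Longrightarrow> x \<le> s 0 \<Longrightarrow> 0 \<le> u x 0"
    and init_flux: "w 0 0 < 0"
begin

section \<open>Continuity on slices and the maximum principle\<close>

lemma cont_s: "continuous_on {0..} s"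
  by (rule DERIV_continuous_on[OF deriv_s]) auto

lemma cont_slice:
  fixes \<phi> :: "real \<Rightarrow> real \<Rightarrow> real"
  assumes "continuous_on (stefan_domain s) (\<lambda>(x, t). \<phi> x t)" "0 \<le> t"
  shows "continuous_on {0..s t} (\<lambda>x. \<phi> x t)"
proof -
  have "continuous_on {0..s t} ((\<lambda>(x, t). \<phi> x t) \<circ> (\<lambda>x. (x, t)))"
    using assms(2)
    by (intro continuous_on_compose continuous_on_subset[OF assms(1)] continuous_intros)
      (auto simp: stefan_domain_def)
  then show ?thesis by (simp add: o_def)
qed

lemma cont_slice_pos:
  assumes "continuous_on (stefan_domain_pos s) (\<lambda>(x, t). \<phi> x t)" "0 < t"
  shows "continuous_on {0..s t} (\<lambda>x. \<phi> x t)"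
proof -
  have "continuous_on {0..s t} ((\<lambda>(x, t). \<phi> x t) \<circ> (\<lambda>x. (x, t)))"
    using assms(2)
    by (intro continuous_on_compose continuous_on_subset[OF assms(1)] continuous_intros)
      (auto simp: stefan_domain_pos_def)
  then show ?thesis by (simp add: o_def)
qed

lemma cont_boundary:
  fixes \<phi> :: "real \<Rightarrow> real \<Rightarrow> real"
  assumes "continuous_on (stefan_domain s) (\<lambda>(x, t). \<phi> x t)"
  shows "continuous_on {0..} (\<lambda>t. \<phi> 0 t)"
proof -
  have "continuous_on {0..} ((\<lambda>(x, t). \<phi> x t) \<circ> (\<lambda>t. (0, t)))"
    by (intro continuous_on_compose continuous_on_subset[OF assms] continuous_intros)
      (auto simp: stefan_domain_def intro: less_imp_le s_pos)
  then show ?thesis by (simp add: o_def)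
qed

text \<open>Rescaling to a fixed interval turns the moving limit of integration into a parameter of the
  integrand.\<close>

lemma cont_strip:
  fixes \<phi> :: "real \<Rightarrow> real \<Rightarrow> real"
  assumes "continuous_on (stefan_domain s) (\<lambda>(x, t). \<phi> x t)"
    and a: "0 \<le> a" and I: "I \<subseteq> {0..}" "\<And>t. t \<in> I \<Longrightarrow> a \<le> s t"
  shows "continuous_on I (\<lambda>t. integral {0..1} (\<lambda>y. \<phi> (a + y * (s t - a)) t))"
proof -
  have dom: "(a + y * (s t - a), t) \<in> stefan_domain s" if "t \<in> I" "0 \<le> y" "y \<le> 1" for t y
  proof -
    have "y * (s t - a) \<le> 1 * (s t - a)" "0 \<le> y * (s t - a)"
      using that I(2)[of t] a by (intro mult_right_mono mult_nonneg_nonneg; simp)+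
    then show ?thesis using that I a by (auto simp: stefan_domain_def)
  qed
  have "continuous_on (I \<times> {0..1}) (\<lambda>p. s (fst p))"
    using I by (intro continuous_on_compose2[OF cont_s] continuous_on_fst continuous_on_id) auto
  then have "continuous_on (I \<times> {0..1}) (\<lambda>p. (a + snd p * (s (fst p) - a), fst p))"
    by (intro continuous_on_Pair continuous_on_add continuous_on_mult continuous_on_diff
        continuous_on_const continuous_on_fst continuous_on_snd continuous_on_id)
  then have "continuous_on (I \<times> {0..1})
      (\<lambda>p. (\<lambda>(x, t). \<phi> x t) (a + snd p * (s (fst p) - a), fst p))"
    by (rule continuous_on_compose2[OF assms(1)]) (use dom in auto)
  then have "continuous_on (I \<times> cbox 0 1) (\<lambda>(t, y). \<phi> (a + y * (s t - a)) t)"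
    by (simp add: case_prod_unfold)
  from integral_continuous_on_param[OF this] show ?thesis by simp
qed

lemma strip_scale:
  fixes \<phi> :: "real \<Rightarrow> real \<Rightarrow> real"
  assumes "continuous_on (stefan_domain s) (\<lambda>(x, t). \<phi> x t)" "0 \<le> a" "a \<le> s t" "0 \<le> t"
  shows "integral {a..s t} (\<lambda>x. \<phi> x t) =
    (s t - a) * integral {0..1} (\<lambda>y. \<phi> (a + y * (s t - a)) t)"
  using assms by (intro integral_scale_unit continuous_on_subset[OF cont_slice[OF assms(1,4)]]) auto

lemma cont_integral:
  fixes \<phi> :: "real \<Rightarrow> real \<Rightarrow> real"
  assumes "continuous_on (stefan_domain s) (\<lambda>(x, t). \<phi> x t)"
  shows "continuous_on {0..} (\<lambda>t. integral {0..s t} (\<lambda>x. \<phi> x t))"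
proof -
  have "continuous_on {0..} (\<lambda>t. (s t - 0) * integral {0..1} (\<lambda>y. \<phi> (0 + y * (s t - 0)) t))"
    by (intro continuous_intros cont_s cont_strip assms) (auto intro: less_imp_le s_pos)
  moreover have "(s t - 0) * integral {0..1} (\<lambda>y. \<phi> (0 + y * (s t - 0)) t) = integral {0..s t} (\<lambda>x. \<phi> x t)"
    if "t \<in> {0..}" for t
    using that by (intro strip_scale[symmetric] assms) (auto intro: less_imp_le s_pos)
  ultimately show ?thesis by (rule continuous_on_eq)
qed

text \<open>The region is the continuous image of a rectangle under the map that stretches the unit
  interval to \<open>{0..s t}\<close>.\<close>

lemma compact_domain: "compact {(x, t). 0 \<le> t \<and> t \<le> t1 \<and> 0 \<le> x \<and> x \<le> s t}"
proof -
  let ?f = "\<lambda>(y, t). (y * s t, t)"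
  have "compact (?f ` ({0..1} \<times> {0..t1}))"
    unfolding case_prod_unfold
    by (intro compact_continuous_image compact_Times continuous_intros
        continuous_on_compose2[OF cont_s]) auto
  moreover have "?f ` ({0..1} \<times> {0..t1}) = {(x, t). 0 \<le> t \<and> t \<le> t1 \<and> 0 \<le> x \<and> x \<le> s t}" (is "_ = ?R")
  proof
    show "?f ` ({0..1} \<times> {0..t1}) \<subseteq> ?R"
    proof safe
      fix y t :: real assume *: "y \<in> {0..1}" "t \<in> {0..t1}"
      have "y * s t \<le> 1 * s t" using * s_pos[of t] by (intro mult_right_mono) auto
      then show "y * s t \<le> s t" by simp
    qed (auto intro!: mult_nonneg_nonneg less_imp_le[OF s_pos])
    show "?R \<subseteq> ?f ` ({0..1} \<times> {0..t1})"
    proof safe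
      fix x t assume *: "0 \<le> t" "t \<le> t1" "0 \<le> x" "x \<le> s t"
      then have "(x, t) = ?f (x / s t, t)" "(x / s t, t) \<in> {0..1} \<times> {0..t1}"
        using s_pos[OF *(1)] by simp_all
      then show "(x, t) \<in> ?f ` ({0..1} \<times> {0..t1})" by blast
    qed
  qed
  ultimately show ?thesis by simp
qed

text \<open>A minimum of \<open>u + \<epsilon> t\<close> is attained at \<open>t = 0\<close> or on the interface: the flux condition
  excludes \<open>x = 0\<close>, and \<open>u\<^sub>t = \<alpha> u\<^sub>x\<^sub>x\<close> excludes the interior.\<close>

lemma maximum_principle:
  assumes flux_neg: "\<And>t. 0 \<le> t \<Longrightarrow> t \<le> t1 \<Longrightarrow> w 0 t < 0"
    and xt: "0 \<le> t" "t \<le> t1" "0 \<le> x" "x \<le> s t"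
  shows "0 \<le> u x t"
proof -
  \<comment> \<open>The term \<open>\<epsilon> * t\<close> makes the contradiction strict: an
    interior minimum would give both \<open>\<theta> x0 t0 + \<epsilon> \<le> 0\<close> and
    \<open>\<theta> x0 t0 = \<alpha> * r x0 t0 \<ge> 0\<close>.\<close>
  have "- (\<epsilon> * t1) \<le> u x t" if \<epsilon>: "\<epsilon> > 0" for \<epsilon>
  proof -
    let ?K = "{(x, t). 0 \<le> t \<and> t \<le> t1 \<and> 0 \<le> x \<and> x \<le> s t}"
    let ?z = "\<lambda>p. u (fst p) (snd p) + \<epsilon> * snd p"
    have sub: "?K \<subseteq> stefan_domain s" by (auto simp: stefan_domain_def)
    have "continuous_on ?K (\<lambda>p. u (fst p) (snd p))"
      using continuous_on_subset[OF cont_u sub] by (simp only: case_prod_unfold)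
    then have cz: "continuous_on ?K ?z" by (intro continuous_intros)
    have "(x, t) \<in> ?K" using xt by auto
    then have ne: "?K \<noteq> {}" by (metis empty_iff)
    obtain p where p: "p \<in> ?K" "\<forall>q\<in>?K. ?z p \<le> ?z q"
      by (rule bexE[OF continuous_attains_inf[OF compact_domain ne cz]])
    obtain x0 t0 where p_eq: "p = (x0, t0)" by force
    have x0: "0 \<le> t0" "t0 \<le> t1" "0 \<le> x0" "x0 \<le> s t0" using p(1) p_eq by auto
    have min: "u x0 t0 + \<epsilon> * t0 \<le> u y \<tau> + \<epsilon> * \<tau>"
      if "0 \<le> \<tau>" "\<tau> \<le> t1" "0 \<le> y" "y \<le> s \<tau>" for y \<tau>
      using bspec[OF p(2), of "(y, \<tau>)"] that p_eq by simp
    have "0 \<le> u x0 t0"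
    proof (cases "t0 = 0 \<or> x0 = s t0")
      case True
      then show ?thesis using init_nonneg u_s x0 by auto
    next
      case False
      then have t0: "t0 > 0" "x0 < s t0" using x0 by auto
      show ?thesis
      proof (cases "x0 = 0")
        case True
        have "0 \<le> w x0 t0"
          using has_real_derivative_at_right_nonneg_at_min[OF deriv_u[OF x0(1,3,4)], of "s t0"]
            min[of t0] x0 s_pos[of t0] True by auto
        then show ?thesis using flux_neg[OF x0(1,2)] True by simp
      next
        case False
        then have x0': "x0 > 0" using x0 by simp
        have inner: "at y within {0..s t0} = at y" if "0 < y" "y < s t0" for y
          using that by (simp add: at_within_Icc_at)
        have "0 \<le> r x0 t0"
        proof (rule second_derivative_nonneg_at_min[of 0 "s t0" "\<lambda>y. u y t0" "\<lambda>y. w y t0"])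
          show "((\<lambda>y. u y t0) has_real_derivative w y t0) (at y)" if "0 < y" "y < s t0" for y
            using deriv_u[of t0 y] inner[OF that] that x0 by simp
          show "((\<lambda>y. w y t0) has_real_derivative r x0 t0) (at x0)"
            using deriv_w[of t0 x0] inner[of x0] x0' t0 by simp
        qed (use min[of t0] x0 t0 x0' in auto)
        moreover have "\<theta> x0 t0 + \<epsilon> \<le> 0"
        proof -
          \<comment> \<open>As \<open>t0\<close> may be the final time, only earlier times are
            compared; continuity of \<open>s\<close> keeps \<open>x0\<close> inside the domain
            there.\<close>
          have "\<exists>d>0. \<forall>y\<ge>0. \<bar>y - t0\<bar> < d \<longrightarrow> \<bar>s y - s t0\<bar> < s t0 - x0"
            using cont_s t0 x0 unfolding continuous_on_iff dist_real_def
            by (metis atLeast_iff diff_gt_0_iff_gt)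
          then obtain d where d: "d > 0" "\<And>y. y \<ge> 0 \<Longrightarrow> \<bar>y - t0\<bar> < d \<Longrightarrow> \<bar>s y - s t0\<bar> < s t0 - x0"
            by auto
          define e where "e = min (d/2) t0"
          have e: "e > 0" "e < d" "e \<le> t0" using d(1) t0 by (auto simp: e_def)
          have near: "0 \<le> \<tau> \<and> x0 \<le> s \<tau>" if "t0 - e \<le> \<tau>" "\<tau> \<le> t0" for \<tau>
            using d(2)[of \<tau>] that e by auto
          have "((\<lambda>\<tau>. u x0 \<tau> + \<epsilon> * \<tau>) has_real_derivative \<theta> x0 t0 + \<epsilon> * 1)
              (at t0 within {\<tau>. 0 \<le> \<tau> \<and> x0 \<le> s \<tau>})"
            by (intro DERIV_add deriv_t DERIV_cmult DERIV_ident) (use t0 x0 in auto)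
          then show ?thesis
            using has_real_derivative_at_left_nonpos_at_min[of "\<lambda>\<tau>. u x0 \<tau> + \<epsilon> * \<tau>" "\<theta> x0 t0 + \<epsilon>" t0 _ e]
              near e min x0 by fastforce
        qed
        moreover have "\<theta> x0 t0 = \<alpha> * r x0 t0" using heat t0 x0 by simp
        ultimately show ?thesis using \<alpha> \<epsilon> by (smt (verit) mult_nonneg_nonneg)
      qed
    qed
    then have "0 \<le> u x t + \<epsilon> * t" using min[OF xt] x0 \<epsilon> by (smt (verit) mult_nonneg_nonneg)
    moreover have "\<epsilon> * t \<le> \<epsilon> * t1" using xt \<epsilon> by simp
    ultimately show ?thesis by linarith
  qed
  note * = this
  show ?thesis
  proof (rule field_le_epsilon)
    fix e :: real assume "e > 0"
    \<comment> \<open>The summand 1 avoids division by zero when \<open>t1 = 0\<close>.\<close>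
    have "e / (t1 + 1) * t1 \<le> e" using \<open>e > 0\<close> xt by (simp add: field_simps)
    then show "0 \<le> u x t + e" using *[of "e / (t1 + 1)"] \<open>e > 0\<close> xt by (simp add: add_nonneg_pos)
  qed
qed

text \<open>By the maximum principle, the interface, where \<open>u\<close> vanishes, minimizes each
  slice. The sign of the flux is assumed only up to \<open>t1\<close>, so that the proof of
  \<open>flux_neg\<close> can use this before the sign is known for all times.\<close>

lemma w_interface_nonpos:
  assumes flux_neg: "\<And>t. 0 \<le> t \<Longrightarrow> t \<le> t1 \<Longrightarrow> w 0 t < 0" and z: "0 \<le> z" "z \<le> t1"
  shows "w (s z) z \<le> 0"
proof -
  have "((\<lambda>y. u y z) has_real_derivative w (s z) z) (at (s z) within {0..s z})"
    using deriv_u[of z "s z"] z s_pos[of z] by simp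
  moreover have "u (s z) z \<le> u y z" if "0 \<le> y" "y \<le> s z" for y
    using maximum_principle[OF flux_neg z that] u_s z by simp
  ultimately show ?thesis
    using has_real_derivative_at_left_nonpos_at_min[of "\<lambda>y. u y z" "w (s z) z" "s z" _ "s z"]
      s_pos[of z] z by auto
qed

lemma s_mono:
  assumes flux_neg: "\<And>t. 0 \<le> t \<Longrightarrow> t \<le> t1 \<Longrightarrow> w 0 t < 0"
    and t: "0 \<le> t" "t \<le> \<tau>" "\<tau> \<le> t1"
  shows "s t \<le> s \<tau>"
proof (rule DERIV_nonneg_imp_increasing_open[OF t(2)])
  show "continuous_on {t..\<tau>} s" using t by (intro continuous_on_subset[OF cont_s]) auto
  fix z assume z: "t < z" "z < \<tau>"
  have "(s has_real_derivative - \<beta> * w (s z) z) (at z)"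
    using deriv_s[of z] z t at_within_interior[of z "{0..}"] by simp
  moreover have "- \<beta> * w (s z) z \<ge> 0"
    using w_interface_nonpos[OF flux_neg, of z] z t \<beta> by (simp add: mult_nonneg_nonpos)
  ultimately show "\<exists>y. (s has_real_derivative y) (at z) \<and> 0 \<le> y" by blast
qed

subsection \<open>Right derivatives of integrals over the moving domain\<close>

text \<open>On this window after \<open>t\<close> the fixed interval \<open>{0..s t}\<close> stays
  inside the domain. \<open>0 < t\<close> is included because \<open>r\<close> and
  \<open>\<theta>\<close> are controlled only at positive times.\<close>

definition rising :: "real \<Rightarrow> real \<Rightarrow> bool" where
  "rising t \<delta> \<longleftrightarrow> 0 < t \<and> 0 < \<delta> \<and> (\<forall>\<tau>\<in>{t..t + \<delta>}. s t \<le> s \<tau>)"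

lemma rising_subset:
  assumes "rising t \<delta>"
  shows "{0..s t} \<times> {t..t + \<delta>} \<subseteq> stefan_domain_pos s" "{0..s t} \<times> {t..t + \<delta>} \<subseteq> stefan_domain s"
proof -
  have "(x, \<tau>) \<in> stefan_domain_pos s \<inter> stefan_domain s" if "x \<in> {0..s t}" "\<tau> \<in> {t..t + \<delta>}" for x \<tau>
    using assms that order_trans[of x "s t" "s \<tau>"]
    by (auto simp: rising_def stefan_domain_pos_def stefan_domain_def)
  then show "{0..s t} \<times> {t..t + \<delta>} \<subseteq> stefan_domain_pos s" "{0..s t} \<times> {t..t + \<delta>} \<subseteq> stefan_domain s"
    by blast+
qed

lemma rising_cont:
  assumes "rising t \<delta>" "continuous_on (stefan_domain s) (\<lambda>(x, t). \<phi> x t)" "0 \<le> x" "x \<le> s t"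
  shows "continuous_on {t..t + \<delta>} (\<lambda>\<tau>. \<phi> x \<tau>)"
proof -
  have "continuous_on {t..t + \<delta>} (\<lambda>\<tau>. (\<lambda>(x, t). \<phi> x t) (x, \<tau>))"
    by (rule continuous_on_compose2[OF assms(2)])
      (use rising_subset(2)[OF assms(1)] assms(3,4) in \<open>auto intro!: continuous_intros\<close>)
  then show ?thesis by simp
qed

text \<open>The fundamental theorem of calculus in time. Rescaling to \<open>{0..1}\<close> keeps
  the mean value meaningful at \<open>\<tau> = t\<close>, where it equals
  \<open>\<theta> x t\<close>.\<close>

lemma time_increment:
  assumes R: "rising t \<delta>" and x: "0 \<le> x" "x \<le> s t" and \<tau>: "t \<le> \<tau>" "\<tau> \<le> t + \<delta>"
  shows "u x \<tau> - u x t = (\<tau> - t) * integral {0..1} (\<lambda>y. \<theta> x (t + y * (\<tau> - t)))"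
proof -
  have ge: "0 \<le> z \<and> x \<le> s z" if "t \<le> z" "z \<le> \<tau>" for z
    using R that x \<tau> order_trans[of x "s t" "s z"] by (auto simp: rising_def)
  have "(\<theta> x has_integral u x \<tau> - u x t) {t..\<tau>}"
  proof (rule fundamental_theorem_of_calculus[OF \<tau>(1)])
    fix z assume z: "z \<in> {t..\<tau>}"
    have "((\<lambda>\<tau>. u x \<tau>) has_real_derivative \<theta> x z) (at z within {\<tau>. 0 \<le> \<tau> \<and> x \<le> s \<tau>})"
      using R x z ge[of z] by (intro deriv_t) (auto simp: rising_def)
    then have "((\<lambda>\<tau>. u x \<tau>) has_real_derivative \<theta> x z) (at z within {t..\<tau>})"
      by (rule has_field_derivative_subset) (use ge in auto)
    then show "(u x has_vector_derivative \<theta> x z) (at z within {t..\<tau>})"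
      by (simp add: has_real_derivative_iff_has_vector_derivative)
  qed
  then have "u x \<tau> - u x t = integral {t..\<tau>} (\<theta> x)" by (simp add: integral_unique)
  also have "\<dots> = (\<tau> - t) * integral {0..1} (\<lambda>y. \<theta> x (t + y * (\<tau> - t)))"
  proof (rule integral_scale_unit[OF \<tau>(1)])
    have "continuous_on {t..\<tau>} (\<lambda>z. (\<lambda>(x, t). \<theta> x t) (x, z))"
      by (rule continuous_on_compose2[OF cont_\<theta>])
        (use rising_subset(1)[OF R] x \<tau> in \<open>auto intro!: continuous_intros\<close>)
    then show "continuous_on {t..\<tau>} (\<theta> x)" by simp
  qed
  finally show ?thesis .
qed

text \<open>By \<open>time_increment\<close> the difference quotients of \<open>u\<close> in time extend continuously to \<open>\<tau> = t\<close>,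
  so no estimate is needed to pass to the limit under the integral.\<close>

lemma deriv_time_integral:
  assumes R: "rising t \<delta>" and \<rho>: "continuous_on ({0..s t} \<times> {t..t + \<delta>}) (\<lambda>(x, \<tau>). \<rho> x \<tau>)"
  shows "((\<lambda>\<tau>. integral {0..s t} (\<lambda>x. (u x \<tau> - u x t) * \<rho> x \<tau>)) has_real_derivative
    integral {0..s t} (\<lambda>x. \<theta> x t * \<rho> x t)) (at_right t)"
proof -
  let ?I = "{t..t + \<delta>}" and ?L = "s t"
  have \<delta>: "0 < \<delta>" "0 < t" using R by (auto simp: rising_def)
  define q where "q x \<tau> = integral {0..1} (\<lambda>y. \<theta> x (t + y * (\<tau> - t)))" for x \<tau>
  define G where "G \<tau> = integral {0..?L} (\<lambda>x. q x \<tau> * \<rho> x \<tau>)" for \<tau>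
  have "continuous_on (({0..?L} \<times> ?I) \<times> {0..1})
      (\<lambda>p. (\<lambda>(x, t). \<theta> x t) (fst (fst p), t + snd p * (snd (fst p) - t)))"
  proof (rule continuous_on_compose2[OF cont_\<theta>])
    show "continuous_on (({0..?L} \<times> ?I) \<times> {0..1}) (\<lambda>p. (fst (fst p), t + snd p * (snd (fst p) - t)))"
      by (intro continuous_on_Pair continuous_on_add continuous_on_mult continuous_on_diff
          continuous_on_const continuous_on_fst continuous_on_snd continuous_on_id)
    have "t + y * (\<tau> - t) \<in> ?I" if "\<tau> \<in> ?I" "0 \<le> y" "y \<le> 1" for y \<tau>
    proof -
      have "y * (\<tau> - t) \<le> 1 * (\<tau> - t)" "0 \<le> y * (\<tau> - t)"
        using that by (intro mult_right_mono mult_nonneg_nonneg; simp)+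
      then show ?thesis using that by simp
    qed
    then show "(\<lambda>p. (fst (fst p), t + snd p * (snd (fst p) - t))) ` (({0..?L} \<times> ?I) \<times> {0..1})
        \<subseteq> stefan_domain_pos s"
      by (intro subset_trans[OF _ rising_subset(1)[OF R]]) auto
  qed
  then have "continuous_on (({0..?L} \<times> ?I) \<times> cbox 0 1) (\<lambda>(p, y). \<theta> (fst p) (t + y * (snd p - t)))"
    by (simp add: case_prod_unfold)
  from integral_continuous_on_param[OF this]
  have q: "continuous_on ({0..?L} \<times> ?I) (\<lambda>p. q (fst p) (snd p))" by (simp add: q_def)
  have "continuous_on ({0..?L} \<times> ?I) (\<lambda>p. q (fst p) (snd p) * \<rho> (fst p) (snd p))"
    using \<rho> by (intro continuous_on_mult q) (simp add: case_prod_unfold)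
  \<comment> \<open>The arguments are exchanged because \<open>integral_continuous_on_param\<close>
    takes the parameter, here \<open>\<tau>\<close>, as first component.\<close>
  then have "continuous_on (?I \<times> {0..?L}) (\<lambda>p. q (fst (snd p, fst p)) (snd (snd p, fst p))
      * \<rho> (fst (snd p, fst p)) (snd (snd p, fst p)))"
    by (rule continuous_on_compose2[of "{0..?L} \<times> ?I"])
      (auto intro!: continuous_on_Pair continuous_on_fst continuous_on_snd continuous_on_id)
  then have "continuous_on (?I \<times> cbox 0 ?L) (\<lambda>(\<tau>, x). q x \<tau> * \<rho> x \<tau>)"
    by (simp add: case_prod_unfold)
  from integral_continuous_on_param[OF this] have G: "continuous_on ?I G"
    unfolding G_def by simp
  have "((\<lambda>\<tau>. (\<tau> - t) * G \<tau>) has_real_derivative 1 * G t) (at t within ?I)"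
  proof (rule has_real_derivative_mult_zero)
    show "((\<lambda>\<tau>. \<tau> - t) has_real_derivative 1) (at t within ?I)"
      by (auto intro!: derivative_eq_intros)
    show "(G \<longlongrightarrow> G t) (at t within ?I)"
      using G \<delta> by (simp add: continuous_on_def)
  qed simp
  then have "((\<lambda>\<tau>. integral {0..?L} (\<lambda>x. (u x \<tau> - u x t) * \<rho> x \<tau>)) has_real_derivative 1 * G t)
      (at t within ?I)"
  proof (rule has_field_derivative_transform_within[of _ _ _ _ 1])
    fix \<tau> assume "\<tau> \<in> ?I"
    then have "integral {0..?L} (\<lambda>x. (u x \<tau> - u x t) * \<rho> x \<tau>)
        = integral {0..?L} (\<lambda>x. (\<tau> - t) * (q x \<tau> * \<rho> x \<tau>))"
      by (intro integral_cong) (simp add: time_increment[OF R] q_def)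
    then show "(\<tau> - t) * G \<tau> = integral {0..?L} (\<lambda>x. (u x \<tau> - u x t) * \<rho> x \<tau>)"
      by (simp add: G_def)
  qed (use \<delta> in auto)
  moreover have "G t = integral {0..?L} (\<lambda>x. \<theta> x t * \<rho> x t)" by (simp add: G_def q_def)
  moreover have "at t within ?I = at_right t" using \<delta> by (simp add: at_within_Icc_at_right)
  ultimately show ?thesis by simp
qed

text \<open>The strip integral is the width, which vanishes at \<open>t\<close>, times a mean value,
  so the product rule at a zero applies and \<open>\<phi>\<close> need only be continuous.\<close>

lemma deriv_strip:
  fixes \<phi> :: "real \<Rightarrow> real \<Rightarrow> real"
  assumes R: "rising t \<delta>" and \<phi>: "continuous_on (stefan_domain s) (\<lambda>(x, t). \<phi> x t)"
  shows "((\<lambda>\<tau>. integral {s t..s \<tau>} (\<lambda>x. \<phi> x \<tau>)) has_real_derivative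
    - \<beta> * w (s t) t * \<phi> (s t) t) (at_right t)"
proof -
  let ?I = "{t..t + \<delta>}" and ?L = "s t"
  have \<delta>: "0 < \<delta>" "0 < t" and up: "\<And>\<tau>. \<tau> \<in> ?I \<Longrightarrow> ?L \<le> s \<tau>" using R by (auto simp: rising_def)
  define G where "G \<tau> = integral {0..1} (\<lambda>y. \<phi> (?L + y * (s \<tau> - ?L)) \<tau>)" for \<tau>
  have G: "continuous_on ?I G"
    unfolding G_def using \<delta> up s_pos[of t] by (intro cont_strip \<phi>) auto
  have "((\<lambda>\<tau>. (s \<tau> - s t) * G \<tau>) has_real_derivative - \<beta> * w (s t) t * G t) (at t within ?I)"
  proof (rule has_real_derivative_mult_zero)
    have "(s has_real_derivative - \<beta> * w (s t) t) (at t within ?I)"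
      using \<delta> by (intro has_field_derivative_subset[OF deriv_s]) auto
    from DERIV_diff[OF this DERIV_const]
    show "((\<lambda>\<tau>. s \<tau> - s t) has_real_derivative - \<beta> * w (s t) t) (at t within ?I)" by simp
    show "(G \<longlongrightarrow> G t) (at t within ?I)"
      using G \<delta> by (simp add: continuous_on_def)
  qed simp
  then have "((\<lambda>\<tau>. integral {s t..s \<tau>} (\<lambda>x. \<phi> x \<tau>)) has_real_derivative - \<beta> * w (s t) t * G t)
      (at t within ?I)"
  proof (rule has_field_derivative_transform_within[of _ _ _ _ 1])
    fix \<tau> assume "\<tau> \<in> ?I"
    then show "(s \<tau> - s t) * G \<tau> = integral {s t..s \<tau>} (\<lambda>x. \<phi> x \<tau>)"
      unfolding G_def using up \<delta> s_pos[of t] by (intro strip_scale[symmetric] \<phi>) auto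
  qed (use \<delta> in auto)
  moreover have "G t = \<phi> (s t) t" by (simp add: G_def)
  moreover have "at t within ?I = at_right t" using \<delta> by (simp add: at_within_Icc_at_right)
  ultimately show ?thesis by simp
qed

lemma transform_right:
  assumes "(f has_real_derivative d) (at_right t)" and "0 < \<delta>"
    and "\<And>\<tau>. t \<le> \<tau> \<Longrightarrow> \<tau> \<le> t + \<delta> \<Longrightarrow> f \<tau> = g \<tau>"
  shows "(g has_real_derivative d) (at_right t)"
proof -
  have eq: "at t within {t..t + \<delta>} = at_right t" using assms(2) by (simp add: at_within_Icc_at_right)
  show ?thesis
    using has_field_derivative_transform_within[of f d t "{t..t + \<delta>}" 1 g] assms unfolding eq by auto
qed

text \<open>Separates the change on the fixed interval, the newly gained strip and a constant. The
  strip is left to \<open>deriv_strip\<close>; the change is treated through difference quotients of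
  \<open>u\<close> in time.\<close>

lemma split_integral:
  fixes \<phi> :: "real \<Rightarrow> real \<Rightarrow> real"
  assumes R: "rising t \<delta>" and \<phi>: "continuous_on (stefan_domain s) (\<lambda>(x, t). \<phi> x t)"
    and \<tau>: "t \<le> \<tau>" "\<tau> \<le> t + \<delta>"
  shows "integral {0..s \<tau>} (\<lambda>x. \<phi> x \<tau>) = integral {0..s t} (\<lambda>x. \<phi> x \<tau> - \<phi> x t)
    + integral {s t..s \<tau>} (\<lambda>x. \<phi> x \<tau>) + integral {0..s t} (\<lambda>x. \<phi> x t)"
proof -
  have st: "0 < t" "0 < s t" "s t \<le> s \<tau>" using R \<tau> s_pos[of t] by (auto simp: rising_def)
  have i: "(\<lambda>x. \<phi> x z) integrable_on {0..s z}" if "z > 0" for z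
    using cont_slice[OF \<phi>, of z] that by (intro integrable_continuous_real) simp
  have "(\<lambda>x. \<phi> x \<tau>) integrable_on {0..s t}"
    by (rule integrable_subinterval_real[OF i[of \<tau>]]) (use st \<tau> in auto)
  then have "integral {0..s t} (\<lambda>x. \<phi> x \<tau> - \<phi> x t)
      = integral {0..s t} (\<lambda>x. \<phi> x \<tau>) - integral {0..s t} (\<lambda>x. \<phi> x t)"
    using i[of t] st by (intro integral_diff) auto
  moreover have "integral {0..s t} (\<lambda>x. \<phi> x \<tau>) + integral {s t..s \<tau>} (\<lambda>x. \<phi> x \<tau>)
      = integral {0..s \<tau>} (\<lambda>x. \<phi> x \<tau>)"
    by (rule Henstock_Kurzweil_Integration.integral_combine[OF _ _ i[of \<tau>]]) (use st \<tau> in auto)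
  ultimately show ?thesis by simp
qed

section \<open>Evolution of mass, boundary flux and energy\<close>

lemma integral_deriv:
  fixes f g :: "real \<Rightarrow> real"
  assumes "0 \<le> a" "a \<le> b" "b \<le> s t"
    and "\<And>x. 0 \<le> x \<Longrightarrow> x \<le> s t \<Longrightarrow> (f has_real_derivative g x) (at x within {0..s t})"
  shows "(g has_integral f b - f a) {a..b}"
proof (rule fundamental_theorem_of_calculus[OF assms(2)])
  fix x assume "x \<in> {a..b}"
  then have "(f has_real_derivative g x) (at x within {a..b})"
    using assms by (intro has_field_derivative_subset[OF assms(4)]) auto
  then show "(f has_vector_derivative g x) (at x within {a..b})"
    by (simp add: has_real_derivative_iff_has_vector_derivative)
qed

lemma integral_r:
  assumes "0 < t" "0 \<le> x" "x \<le> s t"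
  shows "(\<lambda>x. r x t) integrable_on {0..x}" "integral {0..x} (\<lambda>x. r x t) = w x t - w 0 t"
  using integral_deriv[OF order_refl assms(2,3) deriv_w[OF assms(1)]] by (simp_all add: has_integral_iff)

lemma integral_w:
  assumes "0 \<le> t" "0 \<le> x" "x \<le> s t"
  shows "integral {x..s t} (\<lambda>x. w x t) = - u x t"
  using integral_deriv[OF assms(2,3) order_refl deriv_u[OF assms(1)]] u_s[OF assms(1)]
  by (simp add: has_integral_iff)

text \<open>Integrating the heat equation over a slice leaves the two boundary values of
  \<open>w\<close>; the strip contributes nothing to first order since \<open>u\<close> vanishes at
  the interface.\<close>

lemma deriv_mass:
  assumes R: "rising t \<delta>"
  shows "((\<lambda>\<tau>. integral {0..s \<tau>} (\<lambda>x. u x \<tau>)) has_real_derivative \<alpha> * (w (s t) t - w 0 t)) (at_right t)"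
proof -
  have t: "0 < t" "0 < \<delta>" using R by (auto simp: rising_def)
  have "integral {0..s t} (\<lambda>x. \<theta> x t * 1) = integral {0..s t} (\<lambda>x. \<alpha> * r x t)"
    using heat t by (intro integral_cong) auto
  also have "\<dots> = \<alpha> * (w (s t) t - w 0 t)" using integral_r(2)[of t "s t"] t s_pos[of t] by simp
  finally have *: "integral {0..s t} (\<lambda>x. \<theta> x t * 1) = \<alpha> * (w (s t) t - w 0 t)" .
  have "((\<lambda>\<tau>. integral {0..s t} (\<lambda>x. (u x \<tau> - u x t) * 1) + integral {s t..s \<tau>} (\<lambda>x. u x \<tau>)
      + integral {0..s t} (\<lambda>x. u x t)) has_real_derivative
      integral {0..s t} (\<lambda>x. \<theta> x t * 1) + (- \<beta> * w (s t) t * u (s t) t) + 0) (at_right t)"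
    by (intro DERIV_add deriv_time_integral[OF R] deriv_strip[OF R] cont_u DERIV_const) simp
  then have "((\<lambda>\<tau>. integral {0..s t} (\<lambda>x. (u x \<tau> - u x t) * 1) + integral {s t..s \<tau>} (\<lambda>x. u x \<tau>)
      + integral {0..s t} (\<lambda>x. u x t)) has_real_derivative \<alpha> * (w (s t) t - w 0 t)) (at_right t)"
    using * u_s[of t] t by simp
  then show ?thesis
  proof (rule transform_right[OF _ t(2)])
    show "integral {0..s t} (\<lambda>x. (u x \<tau> - u x t) * 1) + integral {s t..s \<tau>} (\<lambda>x. u x \<tau>)
        + integral {0..s t} (\<lambda>x. u x t) = integral {0..s \<tau>} (\<lambda>x. u x \<tau>)"
      if "t \<le> \<tau>" "\<tau> \<le> t + \<delta>" for \<tau>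
      using split_integral[OF R cont_u that] by simp
  qed
qed

text \<open>The weights \<open>1 / \<alpha>\<close> and \<open>1 / \<beta>\<close> of the control
  law make the interface terms of the mass and of \<open>s\<close> cancel, which leaves a closed
  linear equation.\<close>

lemma deriv_flux:
  assumes R: "rising t \<delta>"
  shows "((\<lambda>\<tau>. w 0 \<tau>) has_real_derivative - c * w 0 t) (at_right t)"
proof -
  have t: "0 < t" "0 < \<delta>" using R by (auto simp: rising_def)
  have "(s has_real_derivative - \<beta> * w (s t) t) (at_right t)"
    using t by (intro has_field_derivative_subset[OF deriv_s]) auto
  then have "((\<lambda>\<tau>. c * (integral {0..s \<tau>} (\<lambda>x. u x \<tau>) / \<alpha> + (s \<tau> - sr) / \<beta>)) has_real_derivative
      c * (\<alpha> * (w (s t) t - w 0 t) / \<alpha> + (- \<beta> * w (s t) t - 0) / \<beta>)) (at_right t)"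
    by (intro DERIV_cmult DERIV_add DERIV_cdivide DERIV_diff DERIV_const deriv_mass[OF R])
  then have "((\<lambda>\<tau>. c * (integral {0..s \<tau>} (\<lambda>x. u x \<tau>) / \<alpha> + (s \<tau> - sr) / \<beta>)) has_real_derivative
      - c * w 0 t) (at_right t)"
    using \<alpha> \<beta> by (simp add: field_simps)
  then show ?thesis
    by (rule transform_right[OF _ t(2)]) (use t flux in auto)
qed

text \<open>A difference of squares factors into \<open>w x \<tau> - w x t\<close>, the spatial
  derivative of \<open>u x \<tau> - u x t\<close>, times a sum. Integration by parts moves the
  derivative onto the sum, so only time increments of \<open>u\<close> occur.\<close>

lemma deriv_energy:
  assumes R: "rising t \<delta>"
  shows "((\<lambda>\<tau>. integral {0..s \<tau>} (\<lambda>x. (w x \<tau>)\<^sup>2)) has_real_derivative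
    - 2 * \<alpha> * integral {0..s t} (\<lambda>x. (r x t)\<^sup>2) + \<beta> * (w (s t) t) ^ 3 - 2 * w 0 t * \<theta> 0 t) (at_right t)"
proof -
  let ?I = "{t..t + \<delta>}" and ?L = "s t"
  have t: "0 < t" "0 < \<delta>" "0 < s t" using R s_pos by (auto simp: rising_def)
  have up: "\<And>\<tau>. t \<le> \<tau> \<Longrightarrow> \<tau> \<le> t + \<delta> \<Longrightarrow> ?L \<le> s \<tau>" using R by (auto simp: rising_def)
  have I: "at t within ?I = at_right t" using t by (simp add: at_within_Icc_at_right)
  have tend: "((\<lambda>\<tau>. w x \<tau> + w x t) \<longlongrightarrow> w x t + w x t) (at_right t)" if "0 \<le> x" "x \<le> ?L" for x
    using rising_cont[OF R cont_w that] t
    by (intro tendsto_add tendsto_const) (simp add: continuous_on_def flip: I)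
  have cont_w2: "continuous_on (stefan_domain s) (\<lambda>(x, t). (w x t)\<^sup>2)"
    using cont_w by (simp add: case_prod_unfold continuous_on_power)
  \<comment> \<open>\<open>u\<close> vanishes at the new interface, so its value at the old one is
    minus the integral of \<open>w\<close> over the strip.\<close>
  have "((\<lambda>\<tau>. - integral {?L..s \<tau>} (\<lambda>x. w x \<tau>)) has_real_derivative - (- \<beta> * w ?L t * w ?L t)) (at_right t)"
    by (intro DERIV_minus deriv_strip[OF R] cont_w)
  then have uL: "((\<lambda>\<tau>. u ?L \<tau>) has_real_derivative - (- \<beta> * w ?L t * w ?L t)) (at_right t)"
    by (rule transform_right[OF _ t(2)]) (use t up in \<open>simp add: integral_w\<close>)
  have "((\<lambda>\<tau>. u 0 \<tau>) has_real_derivative \<theta> 0 t) (at t within {\<tau>. 0 \<le> \<tau> \<and> 0 \<le> s \<tau>})"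
    using t by (intro deriv_t) auto
  then have "((\<lambda>\<tau>. u 0 \<tau>) has_real_derivative \<theta> 0 t) (at_right t)"
    by (rule has_field_derivative_subset) (use t s_pos in \<open>auto intro: less_imp_le\<close>)
  from DERIV_diff[OF this DERIV_const[of "u 0 t"]]
  have u0: "((\<lambda>\<tau>. u 0 \<tau> - u 0 t) has_real_derivative \<theta> 0 t) (at_right t)" by simp
  have D1: "((\<lambda>\<tau>. u ?L \<tau> * (w ?L \<tau> + w ?L t)) has_real_derivative
      - (- \<beta> * w ?L t * w ?L t) * (w ?L t + w ?L t)) (at_right t)"
    using t u_s by (intro has_real_derivative_mult_zero[OF uL _ tend]) auto
  have D2: "((\<lambda>\<tau>. (u 0 \<tau> - u 0 t) * (w 0 \<tau> + w 0 t)) has_real_derivative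
      \<theta> 0 t * (w 0 t + w 0 t)) (at_right t)"
    using t by (intro has_real_derivative_mult_zero[OF u0 _ tend]) auto
  have cont_r2: "continuous_on ({0..?L} \<times> ?I) (\<lambda>(x, \<tau>). r x \<tau> + r x t)"
  proof -
    have "continuous_on ({0..?L} \<times> ?I) (\<lambda>p. (\<lambda>x. r x t) (fst p))"
      by (rule continuous_on_compose2[OF cont_slice_pos[OF cont_r t(1)]])
        (auto intro: continuous_on_fst continuous_on_id)
    moreover have "continuous_on ({0..?L} \<times> ?I) (\<lambda>p. r (fst p) (snd p))"
      using continuous_on_subset[OF cont_r rising_subset(1)[OF R]] by (simp add: case_prod_unfold)
    ultimately show ?thesis by (simp add: case_prod_unfold continuous_on_add)
  qed
  note D3 = deriv_time_integral[OF R cont_r2]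
  note D4 = deriv_strip[OF R cont_w2]
  have D: "((\<lambda>\<tau>. u ?L \<tau> * (w ?L \<tau> + w ?L t) - (u 0 \<tau> - u 0 t) * (w 0 \<tau> + w 0 t)
      - integral {0..?L} (\<lambda>x. (u x \<tau> - u x t) * (r x \<tau> + r x t))
      + integral {?L..s \<tau>} (\<lambda>x. (w x \<tau>)\<^sup>2) + integral {0..?L} (\<lambda>x. (w x t)\<^sup>2)) has_real_derivative
      - (- \<beta> * w ?L t * w ?L t) * (w ?L t + w ?L t) - \<theta> 0 t * (w 0 t + w 0 t)
      - integral {0..?L} (\<lambda>x. \<theta> x t * (r x t + r x t))
      + (- \<beta> * w ?L t * (w ?L t)\<^sup>2) + 0) (at_right t)"
    by (intro DERIV_add DERIV_diff D1 D2 D3 D4 DERIV_const)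
  have "integral {0..?L} (\<lambda>x. \<theta> x t * (r x t + r x t)) = 2 * \<alpha> * integral {0..?L} (\<lambda>x. (r x t)\<^sup>2)"
  proof -
    have "integral {0..?L} (\<lambda>x. \<theta> x t * (r x t + r x t)) = integral {0..?L} (\<lambda>x. 2 * \<alpha> * (r x t)\<^sup>2)"
      using heat t by (intro integral_cong) (auto simp: power2_eq_square)
    then show ?thesis by simp
  qed
  \<comment> \<open>The cube enters with factor 2 from the boundary term at the interface and with
    factor -1 from the strip.\<close>
  then have "- (- \<beta> * w ?L t * w ?L t) * (w ?L t + w ?L t) - \<theta> 0 t * (w 0 t + w 0 t)
      - integral {0..?L} (\<lambda>x. \<theta> x t * (r x t + r x t)) + (- \<beta> * w ?L t * (w ?L t)\<^sup>2) + 0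
    = - 2 * \<alpha> * integral {0..?L} (\<lambda>x. (r x t)\<^sup>2) + \<beta> * (w ?L t) ^ 3 - 2 * w 0 t * \<theta> 0 t"
    by (simp only:) (simp add: power2_eq_square power3_eq_cube algebra_simps)
  note D = D[unfolded this]
  show ?thesis
  proof (rule transform_right[OF D t(2)])
    fix \<tau> assume \<tau>: "t \<le> \<tau>" "\<tau> \<le> t + \<delta>"
    have \<tau>0: "0 < \<tau>" using \<tau> t by simp
    have sub: "{0..?L} \<subseteq> {0..s \<tau>}" using up[OF \<tau>] by simp
    have "((\<lambda>x. (w x \<tau> - w x t) * (w x \<tau> + w x t) + (r x \<tau> + r x t) * (u x \<tau> - u x t)) has_integral
        (u ?L \<tau> - u ?L t) * (w ?L \<tau> + w ?L t) - (u 0 \<tau> - u 0 t) * (w 0 \<tau> + w 0 t)) {0..?L}"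
    proof (rule integral_deriv[where f = "\<lambda>x. (u x \<tau> - u x t) * (w x \<tau> + w x t)" and t = t
          and g = "\<lambda>x. (w x \<tau> - w x t) * (w x \<tau> + w x t) + (r x \<tau> + r x t) * (u x \<tau> - u x t)"
          and a = 0 and b = "s t"])
      fix x assume x: "0 \<le> x" "x \<le> ?L"
      have u\<tau>: "((\<lambda>y. u y \<tau>) has_real_derivative w x \<tau>) (at x within {0..?L})"
        by (rule has_field_derivative_subset[OF deriv_u sub]) (use x \<tau>0 up[OF \<tau>] in auto)
      have w\<tau>: "((\<lambda>y. w y \<tau>) has_real_derivative r x \<tau>) (at x within {0..?L})"
        by (rule has_field_derivative_subset[OF deriv_w sub]) (use x \<tau>0 up[OF \<tau>] in auto)
      have ut: "((\<lambda>y. u y t) has_real_derivative w x t) (at x within {0..?L})"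
        by (rule deriv_u) (use x t in auto)
      have wt: "((\<lambda>y. w y t) has_real_derivative r x t) (at x within {0..?L})"
        by (rule deriv_w) (use x t in auto)
      show "((\<lambda>x. (u x \<tau> - u x t) * (w x \<tau> + w x t)) has_real_derivative
          (w x \<tau> - w x t) * (w x \<tau> + w x t) + (r x \<tau> + r x t) * (u x \<tau> - u x t)) (at x within {0..?L})"
        using DERIV_mult[OF DERIV_diff[OF u\<tau> ut] DERIV_add[OF w\<tau> wt]] .
    qed (use t in auto)
    moreover have "(\<lambda>x. (r x \<tau> + r x t) * (u x \<tau> - u x t)) integrable_on {0..?L}"
      using t \<tau>0 by (intro integrable_continuous_real continuous_on_mult continuous_on_add
          continuous_on_diff continuous_on_subset[OF cont_slice_pos[OF cont_r, of \<tau>] sub]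
          continuous_on_subset[OF cont_slice[OF cont_u, of \<tau>] sub]
          cont_slice_pos[OF cont_r, of t] cont_slice[OF cont_u, of t]) simp_all
    ultimately have "((\<lambda>x. (w x \<tau> - w x t) * (w x \<tau> + w x t)) has_integral
        (u ?L \<tau> - u ?L t) * (w ?L \<tau> + w ?L t) - (u 0 \<tau> - u 0 t) * (w 0 \<tau> + w 0 t)
        - integral {0..?L} (\<lambda>x. (r x \<tau> + r x t) * (u x \<tau> - u x t))) {0..?L}"
      by (auto dest: has_integral_diff[OF _ integrable_integral])
    moreover have "(w x \<tau> - w x t) * (w x \<tau> + w x t) = (w x \<tau>)\<^sup>2 - (w x t)\<^sup>2" for x
      by (simp add: power2_eq_square algebra_simps)
    ultimately have "integral {0..?L} (\<lambda>x. (w x \<tau>)\<^sup>2 - (w x t)\<^sup>2)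
      = u ?L \<tau> * (w ?L \<tau> + w ?L t) - (u 0 \<tau> - u 0 t) * (w 0 \<tau> + w 0 t)
        - integral {0..?L} (\<lambda>x. (u x \<tau> - u x t) * (r x \<tau> + r x t))"
      using u_s[of t] t by (simp add: integral_unique mult.commute)
    then show "u ?L \<tau> * (w ?L \<tau> + w ?L t) - (u 0 \<tau> - u 0 t) * (w 0 \<tau> + w 0 t)
      - integral {0..?L} (\<lambda>x. (u x \<tau> - u x t) * (r x \<tau> + r x t))
      + integral {?L..s \<tau>} (\<lambda>x. (w x \<tau>)\<^sup>2) + integral {0..?L} (\<lambda>x. (w x t)\<^sup>2)
      = integral {0..s \<tau>} (\<lambda>x. (w x \<tau>)\<^sup>2)"
      using split_integral[OF R cont_w2 \<tau>] by simp
  qed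
qed

subsection \<open>Exponential decay\<close>

text \<open>The decay law of the flux needs \<open>s\<close> to rise after \<open>t\<close>, which
  in turn needs a negative flux. Comparison with a strictly negative curve that decays faster breaks
  this circle.\<close>

lemma flux_neg:
  assumes "0 \<le> t" shows "w 0 t < 0"
proof -
  \<comment> \<open>The factor 1/2 gives a strict inequality at time 0; the rate
    \<open>2 * c\<close>, larger than \<open>c\<close>, makes the right derivative at contact equal
    to \<open>c * w 0 t < 0\<close>.\<close>
  have "w 0 t + - w 0 0 / 2 * exp (- 2 * c * t) \<le> 0"
  proof (rule right_derivative_barrier[where f = "\<lambda>t. w 0 t + - w 0 0 / 2 * exp (- 2 * c * t)", OF _ _ _ assms])
    show "continuous_on {0..} (\<lambda>t. w 0 t + - w 0 0 / 2 * exp (- 2 * c * t))"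
      by (intro continuous_intros cont_boundary cont_w)
    show "w 0 0 + - w 0 0 / 2 * exp (- 2 * c * 0) < 0" using init_flux by simp
    fix t assume t: "0 < t" and z: "w 0 t + - w 0 0 / 2 * exp (- 2 * c * t) = 0"
      and le: "\<And>\<tau>. 0 \<le> \<tau> \<Longrightarrow> \<tau> \<le> t \<Longrightarrow> w 0 \<tau> + - w 0 0 / 2 * exp (- 2 * c * \<tau>) \<le> 0"
    have neg: "w 0 \<tau> < 0" if "0 \<le> \<tau>" "\<tau> \<le> t" for \<tau>
    proof -
      have "- w 0 0 / 2 * exp (- 2 * c * \<tau>) > 0" using init_flux by (intro mult_pos_pos) auto
      then show ?thesis using le[OF that] by linarith
    qed
    have "\<exists>d>0. \<forall>y\<ge>0. \<bar>y - t\<bar> < d \<longrightarrow> \<bar>w 0 y - w 0 t\<bar> < - w 0 t"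
      using cont_boundary[OF cont_w] neg[of t] t unfolding continuous_on_iff dist_real_def
      by (metis atLeast_iff less_imp_le neg_0_less_iff_less order_refl)
    then obtain d where d: "d > 0" "\<And>y. y \<ge> 0 \<Longrightarrow> \<bar>y - t\<bar> < d \<Longrightarrow> \<bar>w 0 y - w 0 t\<bar> < - w 0 t" by auto
    \<comment> \<open>Continuity carries the sign slightly beyond \<open>t\<close>, which gives
      monotonicity of \<open>s\<close> on a window to the right.\<close>
    have "w 0 \<tau> < 0" if "0 \<le> \<tau>" "\<tau> \<le> t + d / 2" for \<tau>
      using neg[of \<tau>] d(2)[of \<tau>] that d(1) by (cases "\<tau> \<le> t") auto
    then have "rising t (d / 2)"
      unfolding rising_def using t d(1) by (auto intro!: s_mono[of "t + d / 2"])
    note D = deriv_flux[OF this]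
    have "((\<lambda>t. w 0 t + - w 0 0 / 2 * exp (- 2 * c * t)) has_real_derivative
        - c * w 0 t + - w 0 0 / 2 * (exp (- 2 * c * t) * (- 2 * c))) (at_right t)"
      by (intro DERIV_add D) (auto intro!: derivative_eq_intros)
    moreover have "- c * w 0 t + - w 0 0 / 2 * (exp (- 2 * c * t) * (- 2 * c)) = c * w 0 t"
      using z by algebra
    moreover have "c * w 0 t < 0" using neg[of t] t c by (simp add: mult_pos_neg)
    ultimately show "\<exists>d<0. ((\<lambda>t. w 0 t + - w 0 0 / 2 * exp (- 2 * c * t)) has_real_derivative d) (at_right t)"
      by metis
  qed
  moreover have "- w 0 0 / 2 * exp (- 2 * c * t) > 0" using init_flux by (intro mult_pos_pos) auto
  ultimately show ?thesis by linarith
qed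

lemma rising_one: "0 < t \<Longrightarrow> rising t 1"
  unfolding rising_def using flux_neg by (auto intro!: s_mono[of "t + 1"])

lemma u_nonneg: "0 \<le> t \<Longrightarrow> 0 \<le> x \<Longrightarrow> x \<le> s t \<Longrightarrow> 0 \<le> u x t"
  using maximum_principle[of t t x] flux_neg by auto

text \<open>Doubling the initial height and halving the rate leave enough slack for a strict
  barrier: at contact the right derivative is \<open>c / 2 * w 0 t < 0\<close>.\<close>

lemma flux_le:
  assumes "0 \<le> t" shows "- w 0 t \<le> - 2 * w 0 0 * exp (- (c / 2) * t)"
proof -
  let ?f = "\<lambda>t. - w 0 t + 2 * w 0 0 * exp (- (c / 2) * t)"
  have "?f t \<le> 0"
  proof (rule right_derivative_barrier[where f = ?f, OF _ _ _ assms])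
    show "continuous_on {0..} ?f"
      by (intro continuous_intros cont_boundary cont_w)
    show "?f 0 < 0" using init_flux by simp
    fix t assume t: "0 < t" and z: "?f t = 0"
    have "(?f has_real_derivative
        - (- c * w 0 t) + 2 * w 0 0 * (exp (- (c / 2) * t) * (- (c / 2)))) (at_right t)"
      by (intro DERIV_add DERIV_minus deriv_flux[OF rising_one[OF t]]) (auto intro!: derivative_eq_intros)
    moreover have "- (- c * w 0 t) + 2 * w 0 0 * (exp (- (c / 2) * t) * (- (c / 2))) = c / 2 * w 0 t"
      using z by algebra
    moreover have "c / 2 * w 0 t < 0" using flux_neg[of t] t c by (simp add: mult_pos_neg)
    ultimately show "\<exists>d<0. (?f has_real_derivative d) (at_right t)"
      by metis
  qed
  then show ?thesis by linarith
qed

lemma flux_square_le: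
  assumes "0 \<le> t" shows "(w 0 t)\<^sup>2 \<le> 4 * (w 0 0)\<^sup>2 * exp (- c * t)"
proof -
  have "(- w 0 t)\<^sup>2 \<le> (- 2 * w 0 0 * exp (- (c / 2) * t))\<^sup>2"
    using flux_le[OF assms] flux_neg[OF assms] by (intro power_mono) auto
  also have "\<dots> = 4 * (w 0 0)\<^sup>2 * exp (- c * t)"
    by (simp add: power_mult_distrib flip: exp_double)
  finally show ?thesis by simp
qed

text \<open>The mass term of the control law is nonnegative while the whole is negative, so the
  setpoint term must be negative.\<close>

lemma s_less: "0 \<le> t \<Longrightarrow> s t < sr"
proof -
  assume t: "0 \<le> t"
  have "0 \<le> integral {0..s t} (\<lambda>x. u x t)"
    using cont_slice[OF cont_u t] u_nonneg[OF t] by (intro integral_nonneg integrable_continuous_real) auto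
  then have "0 \<le> integral {0..s t} (\<lambda>x. u x t) / \<alpha>" using \<alpha> by simp
  moreover have "integral {0..s t} (\<lambda>x. u x t) / \<alpha> + (s t - sr) / \<beta> < 0"
    using flux_neg[OF t] unfolding flux[OF t] using c by (simp add: mult_less_0_iff)
  ultimately have "(s t - sr) / \<beta> < 0" by linarith
  then show ?thesis using \<beta> by (simp add: divide_less_0_iff)
qed

lemma sr_pos: "0 < sr" using s_less[of 0] s_pos[of 0] by simp

section \<open>Poincare estimates and the Lyapunov functional\<close>

abbreviation energy :: "real \<Rightarrow> real" where
  "energy t \<equiv> integral {0..s t} (\<lambda>x. (w x t)\<^sup>2)"

lemma energy_nonneg: "0 \<le> t \<Longrightarrow> 0 \<le> energy t"
  using cont_slice[OF cont_w, of t]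
  by (intro integral_nonneg integrable_continuous_real continuous_intros) auto

text \<open>\<open>u\<close> vanishes at the interface and is recovered by integrating
  \<open>w\<close> from there; Cauchy-Schwarz and \<open>s t < sr\<close> give the bound.\<close>

lemma u_square_le:
  assumes t: "0 \<le> t" and x: "0 \<le> x" "x \<le> s t"
  shows "(u x t)\<^sup>2 \<le> sr * energy t"
proof -
  have cw: "continuous_on {0..s t} (\<lambda>x. (w x t)\<^sup>2)"
    using cont_slice[OF cont_w t] by (intro continuous_intros)
  have "(u x t)\<^sup>2 = (integral {x..s t} (\<lambda>x. w x t))\<^sup>2" using integral_w[OF t x] by simp
  also have "\<dots> \<le> (s t - x) * integral {x..s t} (\<lambda>x. (w x t)\<^sup>2)"
    using x by (intro integral_square_le continuous_on_subset[OF cont_slice[OF cont_w t]]) auto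
  also have "\<dots> \<le> sr * energy t"
  proof (rule mult_mono)
    show "integral {x..s t} (\<lambda>x. (w x t)\<^sup>2) \<le> energy t"
      using x by (intro integral_subset_le integrable_continuous_real continuous_on_subset[OF cw]) auto
    show "0 \<le> integral {x..s t} (\<lambda>x. (w x t)\<^sup>2)"
      using x by (intro integral_nonneg integrable_continuous_real continuous_on_subset[OF cw]) auto
  qed (use s_less[OF t] x sr_pos in auto)
  finally show ?thesis .
qed

lemma integral_u_square_le:
  assumes t: "0 \<le> t" shows "integral {0..s t} (\<lambda>x. (u x t)\<^sup>2) \<le> sr\<^sup>2 * energy t"
proof -
  have "integral {0..s t} (\<lambda>x. (u x t)\<^sup>2) \<le> integral {0..s t} (\<lambda>x. sr * energy t)"
    using u_square_le[OF t] cont_slice[OF cont_u t]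
    by (intro integral_le integrable_continuous_real continuous_intros) auto
  also have "\<dots> = s t * (sr * energy t)" using s_pos[OF t] by simp
  also have "\<dots> \<le> sr * (sr * energy t)"
    using s_less[OF t] sr_pos energy_nonneg[OF t] by (intro mult_right_mono) auto
  finally show ?thesis by (simp add: power2_eq_square mult.assoc)
qed

lemma mass_square_le:
  assumes t: "0 \<le> t"
  shows "(integral {0..s t} (\<lambda>x. u x t))\<^sup>2 \<le> sr * integral {0..s t} (\<lambda>x. (u x t)\<^sup>2)"
proof -
  have "(integral {0..s t} (\<lambda>x. u x t))\<^sup>2 \<le> (s t - 0) * integral {0..s t} (\<lambda>x. (u x t)\<^sup>2)"
    using s_pos[OF t] cont_slice[OF cont_u t] by (intro integral_square_le) auto
  also have "\<dots> \<le> sr * integral {0..s t} (\<lambda>x. (u x t)\<^sup>2)"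
    using s_less[OF t] cont_slice[OF cont_u t]
    by (intro mult_right_mono integral_nonneg integrable_continuous_real continuous_intros) auto
  finally show ?thesis .
qed

text \<open>A Poincare inequality for \<open>w\<close> anchored at \<open>x = 0\<close>; as
  \<open>w 0 t\<close> is not zero, its square enters on the right.\<close>

lemma energy_le:
  assumes t: "0 < t"
  shows "energy t \<le> 2 * sr\<^sup>2 * integral {0..s t} (\<lambda>x. (r x t)\<^sup>2) + 2 * sr * (w 0 t)\<^sup>2"
proof -
  let ?R = "integral {0..s t} (\<lambda>x. (r x t)\<^sup>2)"
  have t0: "0 \<le> t" using t by simp
  have cr: "continuous_on {0..s t} (\<lambda>x. (r x t)\<^sup>2)"
    using cont_slice_pos[OF cont_r t] by (intro continuous_intros)
  have R0: "0 \<le> ?R" using cr by (intro integral_nonneg integrable_continuous_real) auto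
  have w: "(w x t)\<^sup>2 \<le> 2 * sr * ?R + 2 * (w 0 t)\<^sup>2" if x: "x \<in> {0..s t}" for x
  proof -
    have "(integral {0..x} (\<lambda>x. r x t))\<^sup>2 \<le> (x - 0) * integral {0..x} (\<lambda>x. (r x t)\<^sup>2)"
      using x by (intro integral_square_le continuous_on_subset[OF cont_slice_pos[OF cont_r t]]) auto
    also have "\<dots> \<le> sr * ?R"
    proof (rule mult_mono)
      show "integral {0..x} (\<lambda>x. (r x t)\<^sup>2) \<le> ?R"
        using x by (intro integral_subset_le integrable_continuous_real continuous_on_subset[OF cr]) auto
      show "0 \<le> integral {0..x} (\<lambda>x. (r x t)\<^sup>2)"
        using x by (intro integral_nonneg integrable_continuous_real continuous_on_subset[OF cr]) auto
    qed (use s_less[OF t0] x sr_pos in auto)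
    finally have "(w x t - w 0 t)\<^sup>2 \<le> sr * ?R" using integral_r(2)[OF t, of x] x by simp
    moreover have "(w x t)\<^sup>2 \<le> 2 * (w x t - w 0 t)\<^sup>2 + 2 * (w 0 t)\<^sup>2"
      using sum_square_le[of "w x t - w 0 t" "w 0 t"] by simp
    ultimately show ?thesis by linarith
  qed
  have "energy t \<le> integral {0..s t} (\<lambda>x. 2 * sr * ?R + 2 * (w 0 t)\<^sup>2)"
    using w cont_slice[OF cont_w t0]
    by (intro integral_le integrable_continuous_real continuous_intros) auto
  also have "\<dots> = s t * (2 * sr * ?R + 2 * (w 0 t)\<^sup>2)" using s_pos[OF t0] by simp
  also have "\<dots> \<le> sr * (2 * sr * ?R + 2 * (w 0 t)\<^sup>2)"
    using s_less[OF t0] sr_pos R0 by (intro mult_right_mono add_nonneg_nonneg mult_nonneg_nonneg) auto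
  finally show ?thesis by (simp add: power2_eq_square algebra_simps)
qed

text \<open>The time derivative \<open>u\<^sub>t(0, t)\<close> produced by the energy is unsigned; adding
  \<open>2 u\<^sub>x(0, t) u(0, t)\<close> cancels it, because \<open>u\<^sub>x(0, \<cdot>)\<close> solves a linear differential equation.\<close>

abbreviation lyap :: "real \<Rightarrow> real" where
  "lyap t \<equiv> energy t + 2 * (w 0 t * u 0 t)"

lemma deriv_lyap:
  assumes t: "0 < t"
  obtains d where "(lyap has_real_derivative d) (at_right t)"
    "d \<le> - 2 * decay_rate \<alpha> c sr * lyap t + source_const \<alpha> c sr * (w 0 t)\<^sup>2"
proof
  let ?R = "integral {0..s t} (\<lambda>x. (r x t)\<^sup>2)" and ?b = "decay_rate \<alpha> c sr"
  let ?d = "- 2 * \<alpha> * ?R + \<beta> * (w (s t) t) ^ 3 - 2 * c * (w 0 t * u 0 t)"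
  have t0: "0 \<le> t" and st: "0 < s t" using t s_pos[of t] by auto
  have "((\<lambda>\<tau>. u 0 \<tau>) has_real_derivative \<theta> 0 t) (at t within {\<tau>. 0 \<le> \<tau> \<and> 0 \<le> s \<tau>})"
    using t st by (intro deriv_t) auto
  then have u0: "((\<lambda>\<tau>. u 0 \<tau>) has_real_derivative \<theta> 0 t) (at_right t)"
    by (rule has_field_derivative_subset) (use t s_pos in \<open>auto intro: less_imp_le\<close>)
  have "(lyap has_real_derivative (- 2 * \<alpha> * ?R + \<beta> * (w (s t) t) ^ 3 - 2 * w 0 t * \<theta> 0 t)
      + 2 * ((- c * w 0 t) * u 0 t + \<theta> 0 t * w 0 t)) (at_right t)"
    by (intro DERIV_add DERIV_cmult DERIV_mult deriv_energy[OF rising_one[OF t]] deriv_flux[OF rising_one[OF t]] u0)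
  moreover have "(- 2 * \<alpha> * ?R + \<beta> * (w (s t) t) ^ 3 - 2 * w 0 t * \<theta> 0 t)
      + 2 * ((- c * w 0 t) * u 0 t + \<theta> 0 t * w 0 t) = ?d" by algebra
  ultimately show "(lyap has_real_derivative ?d) (at_right t)" by (simp only:)
  define p where "p = - w 0 t"
  have p: "p > 0" "(w 0 t)\<^sup>2 = p\<^sup>2" "w 0 t * u 0 t = - (p * u 0 t)" using flux_neg[OF t0] by (auto simp: p_def)
  have pu: "0 \<le> p * u 0 t" using p u_nonneg[OF t0, of 0] st by simp
  have "w (s t) t ^ 3 \<le> 0"
    using w_interface_nonpos[of t t] flux_neg t0 by (simp add: power_le_zero_eq)
  then have 1: "\<beta> * (w (s t) t) ^ 3 \<le> 0" using \<beta> by (simp add: mult_nonneg_nonpos)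
  have "\<alpha> / sr\<^sup>2 * energy t \<le> \<alpha> / sr\<^sup>2 * (2 * sr\<^sup>2 * ?R + 2 * sr * (w 0 t)\<^sup>2)"
    using energy_le[OF t] \<alpha> by (intro mult_left_mono) auto
  also have "\<dots> = 2 * \<alpha> * ?R + 2 * \<alpha> / sr * p\<^sup>2"
    using sr_pos p(2) by (simp add: field_simps power2_eq_square)
  finally have 2: "\<alpha> / sr\<^sup>2 * energy t \<le> 2 * \<alpha> * ?R + 2 * \<alpha> / sr * p\<^sup>2" .
  \<comment> \<open>Chosen so that \<open>c * sr / k = \<alpha> / (2 * sr\<^sup>2)\<close>: Young's
    inequality then costs half of the dissipation rate.\<close>
  define k where "k = 2 * sr ^ 3 * c / \<alpha>"
  have k: "k > 0" using \<alpha> c sr_pos by (simp add: k_def)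
  have "2 * c * (p * u 0 t) \<le> c * (k * p\<^sup>2 + (u 0 t)\<^sup>2 / k)"
    using mult_left_mono[OF young_weighted[OF k, of p "u 0 t"], of c] c by (simp add: algebra_simps)
  also have "\<dots> \<le> c * (k * p\<^sup>2 + sr * energy t / k)"
    using u_square_le[OF t0, of 0] st k c by (intro mult_left_mono add_left_mono divide_right_mono) auto
  also have "\<dots> = 2 * sr ^ 3 * c\<^sup>2 / \<alpha> * p\<^sup>2 + \<alpha> / (2 * sr\<^sup>2) * energy t"
    using \<alpha> c sr_pos by (simp add: k_def field_simps power2_eq_square power3_eq_cube)
  finally have 3: "2 * c * (p * u 0 t) \<le> 2 * sr ^ 3 * c\<^sup>2 / \<alpha> * p\<^sup>2 + \<alpha> / (2 * sr\<^sup>2) * energy t" .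
  have b: "2 * ?b \<le> \<alpha> / (2 * sr\<^sup>2)" "0 < ?b"
    using consts_pos(1)[OF \<alpha> \<beta> c sr_pos] by (auto simp: decay_rate_def min_def field_simps)
  have 4: "2 * ?b * energy t \<le> \<alpha> / (2 * sr\<^sup>2) * energy t"
    using b energy_nonneg[OF t0] by (intro mult_right_mono) auto
  \<comment> \<open>Replacing \<open>energy t\<close> by the smaller \<open>lyap t\<close> in the
    damping term weakens the bound by this amount.\<close>
  have 5: "0 \<le> 2 * ?b * (2 * (p * u 0 t))" using b pu by simp
  have 6: "\<alpha> / sr\<^sup>2 * energy t = \<alpha> / (2 * sr\<^sup>2) * energy t + \<alpha> / (2 * sr\<^sup>2) * energy t"
    using sr_pos by (simp add: field_simps)
  have "?d \<le> - 2 * ?b * (energy t - 2 * (p * u 0 t)) + (2 * \<alpha> / sr * p\<^sup>2 + 2 * sr ^ 3 * c\<^sup>2 / \<alpha> * p\<^sup>2)"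
  proof -
    have "2 * ?b * energy t - 2 * ?b * (2 * (p * u 0 t)) = 2 * ?b * (energy t - 2 * (p * u 0 t))"
      by (simp add: algebra_simps)
    then show ?thesis using 1 2 3 4 5 6 unfolding p(3) by linarith
  qed
  then show "?d \<le> - 2 * ?b * lyap t + source_const \<alpha> c sr * (w 0 t)\<^sup>2"
    unfolding p(2,3) source_const_def by (simp add: distrib_right)
qed

text \<open>At contact with the barrier, damping acts at twice the rate of the barrier. One half
  matches the slope of the barrier; the other dominates the source by the second condition on
  \<open>A\<close>, as the squared flux decays at rate \<open>c\<close>, which is no slower.\<close>

lemma lyap_decay:
  assumes t: "0 \<le> t" and A: "lyap 0 < A"
    "4 * source_const \<alpha> c sr * (w 0 0)\<^sup>2 < decay_rate \<alpha> c sr * A"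
  shows "lyap t \<le> A * exp (- decay_rate \<alpha> c sr * t)"
proof -
  let ?b = "decay_rate \<alpha> c sr" and ?C = "source_const \<alpha> c sr"
  let ?f = "\<lambda>t. lyap t - A * exp (- ?b * t)"
  have pos: "?b > 0" "?C > 0" "?b \<le> c"
    using consts_pos[OF \<alpha> \<beta> c sr_pos] c by (auto simp: decay_rate_def min_def)
  have "?f t \<le> 0"
  proof (rule right_derivative_barrier[where f = ?f, OF _ _ _ t])
    have "continuous_on (stefan_domain s) (\<lambda>(x, t). (w x t)\<^sup>2)"
      using cont_w by (simp add: case_prod_unfold continuous_on_power)
    then show "continuous_on {0..} ?f"
      by (intro continuous_intros cont_boundary cont_w cont_u cont_integral)
    show "?f 0 < 0" using A by simp
    fix t assume t: "0 < t" and z: "?f t = 0"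
    obtain d where d: "(lyap has_real_derivative d) (at_right t)"
      "d \<le> - 2 * ?b * lyap t + ?C * (w 0 t)\<^sup>2" using deriv_lyap[OF t] by blast
    have "(?f has_real_derivative d - A * (exp (- ?b * t) * (- ?b))) (at_right t)"
      by (intro DERIV_diff d) (auto intro!: derivative_eq_intros)
    moreover have "d - A * (exp (- ?b * t) * (- ?b)) < 0"
    proof -
      have "exp (- c * t) \<le> exp (- ?b * t)" using pos t by simp
      then have "4 * (w 0 0)\<^sup>2 * exp (- c * t) \<le> 4 * (w 0 0)\<^sup>2 * exp (- ?b * t)"
        by (intro mult_left_mono) auto
      then have "(w 0 t)\<^sup>2 \<le> 4 * (w 0 0)\<^sup>2 * exp (- ?b * t)"
        using flux_square_le[of t] t by linarith
      then have "?C * (w 0 t)\<^sup>2 \<le> ?C * (4 * (w 0 0)\<^sup>2 * exp (- ?b * t))"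
        using pos by (intro mult_left_mono) auto
      also have "\<dots> < ?b * A * exp (- ?b * t)"
        using mult_strict_right_mono[OF A(2), of "exp (- ?b * t)"] by (simp add: mult_ac)
      finally have "d < - 2 * ?b * lyap t + ?b * A * exp (- ?b * t)" using d(2) by linarith
      moreover have "lyap t = A * exp (- ?b * t)" using z by simp
      ultimately show ?thesis by (simp add: mult_ac)
    qed
    ultimately show "\<exists>d<0. (?f has_real_derivative d) (at_right t)" by blast
  qed
  then show ?thesis by simp
qed

section \<open>From the functional to the full error\<close>

abbreviation err :: "real \<Rightarrow> real" where
  "err t \<equiv> integral {0..s t} (\<lambda>x. (u x t)\<^sup>2) + energy t + (s t - sr)\<^sup>2"

text \<open>The control law makes the flux a linear combination of the mass and the setpoint error,
  and the L2 norm bounds the mass.\<close>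

lemma flux_square_le_err: "(w 0 0)\<^sup>2 \<le> flux_const \<alpha> \<beta> c sr * err 0"
proof -
  let ?M = "integral {0..s 0} (\<lambda>x. u x 0)" and ?U = "integral {0..s 0} (\<lambda>x. (u x 0)\<^sup>2)"
  have U: "0 \<le> ?U"
    using cont_slice[OF cont_u, of 0] by (intro integral_nonneg integrable_continuous_real continuous_intros) auto
  have "(w 0 0)\<^sup>2 = c\<^sup>2 * (?M / \<alpha> + (s 0 - sr) / \<beta>)\<^sup>2" using flux[of 0] by (simp add: power_mult_distrib)
  also have "\<dots> \<le> c\<^sup>2 * (2 * (?M / \<alpha>)\<^sup>2 + 2 * ((s 0 - sr) / \<beta>)\<^sup>2)"
    by (intro mult_left_mono sum_square_le) auto
  also have "\<dots> = 2 * c\<^sup>2 * (?M\<^sup>2 / \<alpha>\<^sup>2 + (s 0 - sr)\<^sup>2 / \<beta>\<^sup>2)" by (simp add: power_divide algebra_simps)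
  also have "\<dots> \<le> 2 * c\<^sup>2 * (sr * ?U / \<alpha>\<^sup>2 + (s 0 - sr)\<^sup>2 / \<beta>\<^sup>2)"
    using mass_square_le[of 0] by (intro mult_left_mono add_right_mono divide_right_mono) auto
  also have "\<dots> = 2 * c\<^sup>2 * (sr / \<alpha>\<^sup>2 * ?U + 1 / \<beta>\<^sup>2 * (s 0 - sr)\<^sup>2)" by simp
  also have "\<dots> \<le> 2 * c\<^sup>2 * (sr / \<alpha>\<^sup>2 * err 0 + 1 / \<beta>\<^sup>2 * err 0)"
    using U energy_nonneg[of 0] sr_pos by (intro mult_left_mono add_mono) auto
  also have "\<dots> = flux_const \<alpha> \<beta> c sr * err 0" by (simp add: flux_const_def algebra_simps)
  finally show ?thesis .
qed

lemma energy_decay: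
  assumes t: "0 \<le> t"
  shows "energy t \<le> energy_const \<alpha> \<beta> c sr * err 0 * exp (- decay_rate \<alpha> c sr * t)"
proof -
  let ?b = "decay_rate \<alpha> c sr" and ?C = "source_const \<alpha> c sr" and ?F = "flux_const \<alpha> \<beta> c sr"
  have pos: "?b > 0" "?C > 0" "?F > 0" "?b \<le> c"
    using consts_pos[OF \<alpha> \<beta> c sr_pos] c by (auto simp: decay_rate_def min_def)
  define K where "K = err 0"
  have U: "0 \<le> integral {0..s 0} (\<lambda>x. (u x 0)\<^sup>2)"
    using cont_slice[OF cont_u, of 0] by (intro integral_nonneg integrable_continuous_real continuous_intros) auto
  \<comment> \<open>The interface starts strictly below the setpoint, so \<open>K > 0\<close>; this
    supplies the strict inequalities that \<open>lyap_decay\<close> requires.\<close>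
  have "(s 0 - sr)\<^sup>2 > 0" using s_less[of 0] by simp
  then have K: "K > 0" "energy 0 \<le> K" using U energy_nonneg[of 0] unfolding K_def by linarith+
  have F: "(w 0 0)\<^sup>2 \<le> ?F * K" using flux_square_le_err by (simp add: K_def)
  \<comment> \<open>The summand 2 puts \<open>A\<close> above \<open>lyap 0\<close>, which is at
    most \<open>K\<close>, and leaves room in the source condition; the other summand times
    \<open>?b\<close> equals the bound on the source.\<close>
  define A where "A = (2 + 4 * ?C * ?F / ?b) * K"
  have "w 0 0 * u 0 0 \<le> 0" using init_flux init_nonneg[of 0] s_pos[of 0] by (simp add: mult_nonpos_nonneg)
  moreover have "K < A"
  proof -
    have "0 \<le> 4 * ?C * ?F / ?b * K" using K pos by (intro mult_nonneg_nonneg divide_nonneg_nonneg) auto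
    then show ?thesis using K by (simp add: A_def distrib_right)
  qed
  ultimately have A1: "lyap 0 < A" using K by linarith
  have "4 * ?C * (w 0 0)\<^sup>2 \<le> 4 * ?C * (?F * K)" using F pos by (intro mult_left_mono) auto
  also have "\<dots> < 2 * ?b * K + 4 * ?C * (?F * K)" using pos K by simp
  also have "\<dots> = ?b * A" using pos by (simp add: A_def field_simps)
  finally have "4 * ?C * (w 0 0)\<^sup>2 < ?b * A" .
  note L = lyap_decay[OF t A1 this]
  define p where "p = - w 0 t"
  \<comment> \<open>With weight \<open>2 * sr\<close> the term in \<open>u 0 t\<close> costs half of
    the energy, which can be absorbed on the left.\<close>
  have "2 * p * u 0 t \<le> (2 * sr) * p\<^sup>2 + (u 0 t)\<^sup>2 / (2 * sr)" using sr_pos by (intro young_weighted) simp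
  also have "\<dots> \<le> 2 * sr * p\<^sup>2 + energy t / 2"
    using u_square_le[OF t, of 0] s_pos[OF t] sr_pos by (simp add: field_simps)
  finally have 1: "energy t \<le> 2 * lyap t + 4 * sr * (w 0 t)\<^sup>2" by (simp add: p_def)
  have "exp (- c * t) \<le> exp (- ?b * t)" using pos t by (simp add: mult_right_mono)
  then have "4 * (w 0 0)\<^sup>2 * exp (- c * t) \<le> 4 * (?F * K) * exp (- ?b * t)"
    using F pos K by (intro mult_mono) auto
  then have "(w 0 t)\<^sup>2 \<le> 4 * (?F * K) * exp (- ?b * t)" using flux_square_le[OF t] by linarith
  then have "2 * lyap t + 4 * sr * (w 0 t)\<^sup>2
      \<le> 2 * (A * exp (- ?b * t)) + 4 * sr * (4 * (?F * K) * exp (- ?b * t))"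
    using L sr_pos by (intro add_mono mult_left_mono) auto
  with 1 have "energy t \<le> 2 * (A * exp (- ?b * t)) + 4 * sr * (4 * (?F * K) * exp (- ?b * t))"
    by (rule order_trans)
  also have "\<dots> = energy_const \<alpha> \<beta> c sr * K * exp (- ?b * t)"
    by (simp add: A_def energy_const_def algebra_simps)
  finally show ?thesis by (simp add: K_def)
qed

lemma err_decay:
  assumes t: "0 \<le> t"
  shows "err t \<le> error_const \<alpha> \<beta> c sr * err 0 * exp (- decay_rate \<alpha> c sr * t)"
proof -
  let ?b = "decay_rate \<alpha> c sr" and ?F = "flux_const \<alpha> \<beta> c sr" and ?E = "energy_const \<alpha> \<beta> c sr"
  let ?M = "integral {0..s t} (\<lambda>x. u x t)" and ?U = "integral {0..s t} (\<lambda>x. (u x t)\<^sup>2)"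
  have pos: "?b > 0" "?F > 0" "?b \<le> c"
    using consts_pos[OF \<alpha> \<beta> c sr_pos] c by (auto simp: decay_rate_def min_def)
  define X where "X = err 0 * exp (- ?b * t)"
  have F: "4 * (w 0 0)\<^sup>2 * exp (- c * t) \<le> 4 * (?F * err 0) * exp (- ?b * t)"
    using flux_square_le_err pos t order_trans[OF zero_le_power2 flux_square_le_err]
    by (intro mult_mono) (auto simp: mult_right_mono)
  have w: "(w 0 t)\<^sup>2 \<le> 4 * ?F * X" using flux_square_le[OF t] F by (simp add: X_def mult.assoc)
  have E: "energy t \<le> ?E * X" using energy_decay[OF t] by (simp add: X_def mult.assoc)
  have "?M\<^sup>2 \<le> sr * ?U" by (rule mass_square_le[OF t])
  also have "\<dots> \<le> sr * (sr\<^sup>2 * energy t)" using integral_u_square_le[OF t] sr_pos by simp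
  finally have M: "?M\<^sup>2 \<le> sr ^ 3 * energy t" by (simp add: power2_eq_square power3_eq_cube mult.assoc)
  \<comment> \<open>The control law solved for the setpoint error.\<close>
  have "s t - sr = \<beta> * (w 0 t / c + - (?M / \<alpha>))"
    using flux[OF t] c \<beta> \<alpha> by (simp add: field_simps)
  then have "(s t - sr)\<^sup>2 = \<beta>\<^sup>2 * (w 0 t / c + - (?M / \<alpha>))\<^sup>2" by (simp add: power_mult_distrib)
  also have "\<dots> \<le> \<beta>\<^sup>2 * (2 * (w 0 t / c)\<^sup>2 + 2 * (- (?M / \<alpha>))\<^sup>2)"
    by (intro mult_left_mono sum_square_le) auto
  also have "\<dots> = 2 * \<beta>\<^sup>2 * ((w 0 t)\<^sup>2 / c\<^sup>2 + ?M\<^sup>2 / \<alpha>\<^sup>2)" by (simp add: power_divide algebra_simps)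
  also have "\<dots> \<le> 2 * \<beta>\<^sup>2 * (4 * ?F * X / c\<^sup>2 + sr ^ 3 * energy t / \<alpha>\<^sup>2)"
    using w M by (intro mult_left_mono add_mono divide_right_mono) auto
  also have "\<dots> = 8 * \<beta>\<^sup>2 * ?F / c\<^sup>2 * X + 2 * \<beta>\<^sup>2 * sr ^ 3 / \<alpha>\<^sup>2 * energy t" by (simp add: algebra_simps)
  finally have "err t \<le> (sr\<^sup>2 + 1 + 2 * \<beta>\<^sup>2 * sr ^ 3 / \<alpha>\<^sup>2) * energy t + 8 * \<beta>\<^sup>2 * ?F / c\<^sup>2 * X"
    using integral_u_square_le[OF t] by (simp add: algebra_simps)
  also have "\<dots> \<le> (sr\<^sup>2 + 1 + 2 * \<beta>\<^sup>2 * sr ^ 3 / \<alpha>\<^sup>2) * (?E * X) + 8 * \<beta>\<^sup>2 * ?F / c\<^sup>2 * X"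
    using E sr_pos by (intro add_right_mono mult_left_mono) auto
  also have "\<dots> = error_const \<alpha> \<beta> c sr * X" by (simp add: error_const_def algebra_simps)
  finally show ?thesis by (simp add: X_def mult.assoc)
qed

end

section \<open>Transfer to the closed-loop system\<close>

lemma l2_norm_sq_deriv:
  assumes "\<And>x. 0 < x \<Longrightarrow> x < L \<Longrightarrow> (f has_real_derivative g x) (at x)"
  shows "l2_norm_sq L (deriv f) = integral {0..L} (\<lambda>x. (g x)\<^sup>2)"
  unfolding l2_norm_sq_def
\<comment> \<open>The value of \<open>deriv f\<close> is unknown at the two end points, which form a
  null set.\<close>
proof (rule integral_spike[of "{0, L}"])
  show "(g x)\<^sup>2 = (deriv f x)\<^sup>2" if "x \<in> {0..L} - {0, L}" for x
    using DERIV_imp_deriv[OF assms[of x]] that by auto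
qed simp

text \<open>Instantiates the flow with \<open>T - Tm\<close>. Positivity of \<open>sr\<close>
  appears as a conclusion so that the theorem can treat \<open>sr \<le> 0\<close> as
  vacuous.\<close>

lemma closed_loop_decay:
  fixes \<alpha> \<beta> k Tm c sr s0 :: real
  assumes par: "\<alpha> > 0" "\<beta> > 0" "k > 0" "c > 0"
    and init: "\<forall>x\<in>{0..s0}. 0 \<le> T0 x - Tm"
    and sr: "sr > s0 + \<beta> / \<alpha> * integral {0..s0} (\<lambda>x. T0 x - Tm)"
    and sol: "closed_loop_solution \<alpha> \<beta> k Tm c sr T0 s0 T s"
  shows "sr > 0"
    and "\<And>t x. 0 \<le> t \<Longrightarrow> x \<in> {0..s t} \<Longrightarrow> Tm \<le> T x t"
    and "\<And>t. 0 \<le> t \<Longrightarrow> stefan_error Tm sr T s t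
      \<le> error_const \<alpha> \<beta> c sr * stefan_error Tm sr T s 0 * exp (- decay_rate \<alpha> c sr * t)"
proof -
  obtain w r \<theta> where s: "\<And>t. 0 \<le> t \<Longrightarrow> 0 < s t" "s 0 = s0" "\<And>x. x \<in> {0..s0} \<Longrightarrow> T x 0 = T0 x"
    and cT: "continuous_on (stefan_domain s) (\<lambda>(x, t). T x t)"
    and cw: "continuous_on (stefan_domain s) (\<lambda>(x, t). w x t)"
    and cr: "continuous_on (stefan_domain_pos s) (\<lambda>(x, t). r x t)"
    and c\<theta>: "continuous_on (stefan_domain_pos s) (\<lambda>(x, t). \<theta> x t)"
    and dT: "\<forall>(x, t)\<in>stefan_domain s. ((\<lambda>y. T y t) has_real_derivative w x t) (at x within {0..s t})"
    and dpos: "\<forall>(x, t)\<in>stefan_domain_pos s.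
           ((\<lambda>y. w y t) has_real_derivative r x t) (at x within {0..s t}) \<and>
           ((\<lambda>\<tau>. T x \<tau>) has_real_derivative \<theta> x t) (at t within {\<tau>. 0 \<le> \<tau> \<and> x \<le> s \<tau>}) \<and>
           \<theta> x t = \<alpha> * r x t"
    and bc: "\<forall>t\<ge>0. - k * w 0 t = heat_control \<alpha> \<beta> k Tm c sr (\<lambda>x. T x t) (s t) \<and>
               T (s t) t = Tm \<and> (s has_real_derivative - \<beta> * w (s t) t) (at t within {0..})"
    using sol unfolding closed_loop_solution_def stefan_solution_def
    by (elim conjE exE) (rule that, (assumption | simp)+)
  have flux: "w 0 t = c * (integral {0..s t} (\<lambda>x. T x t - Tm) / \<alpha> + (s t - sr) / \<beta>)" if "0 \<le> t" for t
  proof -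
    have "- k * w 0 t = - c * k * (1 / \<alpha> * integral {0..s t} (\<lambda>x. T x t - Tm) + 1 / \<beta> * (s t - sr))"
      using bc that unfolding heat_control_def by blast
    then have "k * w 0 t = k * (c * (integral {0..s t} (\<lambda>x. T x t - Tm) / \<alpha> + (s t - sr) / \<beta>))"
      by (simp add: mult_ac)
    then show ?thesis using par by simp
  qed
  \<comment> \<open>This sign is the setpoint condition multiplied by
    \<open>c / \<beta>\<close>.\<close>
  have "w 0 0 < 0"
  proof -
    have "integral {0..s0} (\<lambda>x. T x 0 - Tm) = integral {0..s0} (\<lambda>x. T0 x - Tm)"
      using s by (intro integral_cong) auto
    then have "w 0 0 = c / \<beta> * (s0 + \<beta> / \<alpha> * integral {0..s0} (\<lambda>x. T0 x - Tm) - sr)"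
      using flux[of 0] s(2) par by (simp add: field_simps)
    also have "\<dots> < 0" using sr par by (intro mult_pos_neg) auto
    finally show ?thesis .
  qed
  interpret stefan_flow \<alpha> \<beta> c sr "\<lambda>x t. T x t - Tm" w r \<theta> s
  proof
    show "continuous_on (stefan_domain s) (\<lambda>(x, t). T x t - Tm)"
      using continuous_on_diff[OF cT continuous_on_const[of _ Tm]] by (simp add: case_prod_unfold)
    show "((\<lambda>y. T y t - Tm) has_real_derivative w x t) (at x within {0..s t})"
      if "0 \<le> t" "0 \<le> x" "x \<le> s t" for x t
    proof -
      have "((\<lambda>y. T y t) has_real_derivative w x t) (at x within {0..s t})"
        using dT that by (auto simp: stefan_domain_def)
      from DERIV_diff[OF this DERIV_const[of Tm]] show ?thesis by simp
    qed
    show "((\<lambda>\<tau>. T x \<tau> - Tm) has_real_derivative \<theta> x t) (at t within {\<tau>. 0 \<le> \<tau> \<and> x \<le> s \<tau>})"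
      if "0 < t" "0 \<le> x" "x \<le> s t" for x t
    proof -
      have pos: "(x, t) \<in> stefan_domain_pos s" using that by (simp add: stefan_domain_pos_def)
      have "((\<lambda>\<tau>. T x \<tau>) has_real_derivative \<theta> x t) (at t within {\<tau>. 0 \<le> \<tau> \<and> x \<le> s \<tau>})"
        using bspec[OF dpos pos, unfolded prod.case] by blast
      from DERIV_diff[OF this DERIV_const[of Tm]] show ?thesis by simp
    qed
    show "((\<lambda>y. w y t) has_real_derivative r x t) (at x within {0..s t})" "\<theta> x t = \<alpha> * r x t"
      if "0 < t" "0 \<le> x" "x \<le> s t" for x t
      using dpos that by (auto simp: stefan_domain_pos_def)
    show "0 \<le> T x 0 - Tm" if "0 \<le> x" "x \<le> s 0" for x
      using init s that by auto
  qed (use par s cw cr c\<theta> bc flux \<open>w 0 0 < 0\<close> in auto)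
  show "sr > 0" by (rule sr_pos)
  show "Tm \<le> T x t" if "0 \<le> t" "x \<in> {0..s t}" for t x using u_nonneg[of t x] that by simp
  have "stefan_error Tm sr T s t = err t" if "0 \<le> t" for t
  proof -
    have "((\<lambda>y. T y t - Tm) has_real_derivative w x t) (at x)" if "0 < x" "x < s t" for x
      using deriv_u[of t x] \<open>0 \<le> t\<close> that by (simp add: at_within_Icc_at)
    from l2_norm_sq_deriv[OF this] show ?thesis
      by (simp add: stefan_error_def h1_norm_sq_def l2_norm_sq_def[of _ "\<lambda>x. T x t - Tm"])
  qed
  then show "stefan_error Tm sr T s t
      \<le> error_const \<alpha> \<beta> c sr * stefan_error Tm sr T s 0 * exp (- decay_rate \<alpha> c sr * t)" if "0 \<le> t" for t
    using err_decay[OF that] that by simp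
qed

theorem theorem1:
  fixes \<alpha> \<beta> k Tm c sr :: real
  assumes "\<alpha> > 0" and "\<beta> > 0" and "k > 0" and "c > 0"
  shows "\<exists>D>0. \<exists>b>0. \<forall>T0 s0 T s.
           s0 > 0 \<and>
           compatible_initial_data \<alpha> \<beta> k Tm c sr T0 s0 \<and>
           (\<exists>H. \<forall>x\<in>{0..s0}. 0 \<le> T0 x - Tm \<and> T0 x - Tm \<le> H * (s0 - x)) \<and>
           sr > s0 + \<beta> / \<alpha> * integral {0..s0} (\<lambda>x. T0 x - Tm) \<and>
           closed_loop_solution \<alpha> \<beta> k Tm c sr T0 s0 T s \<longrightarrow>
           (\<forall>t\<ge>0. \<forall>x\<in>{0..s t}. T x t \<ge> Tm) \<and>
           (\<forall>t\<ge>0. stefan_error Tm sr T s t \<le> D * stefan_error Tm sr T s 0 * exp (- b * t))"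
\<comment> \<open>\<open>D\<close> and \<open>b\<close> are chosen before the solution, and the
  explicit constants are known to be positive when \<open>sr > 0\<close>. Otherwise no solution
  meets the hypotheses, and 1 serves for both.\<close>
proof (cases "sr > 0")
  case True
  show ?thesis
  proof (rule exI[of _ "error_const \<alpha> \<beta> c sr"], rule conjI[OF _ exI[of _ "decay_rate \<alpha> c sr"]], goal_cases)
    case 1
    show ?case using consts_pos[OF assms(1,2,4) True] by simp
  next
    case 2
    show ?case
      using consts_pos[OF assms(1,2,4) True] closed_loop_decay(2,3)[OF assms] by blast
  qed
next
  case False
  then show ?thesis using closed_loop_decay(1)[OF assms] zero_less_one by blast
qed

end
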